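(* Let $G$ be a finite $2$-connected simple graph with vertex set $V(G)$, and let $M=M(G)$ be its graphic matroid. Then $$\widehat{\rho}(I(M)) \le 2-\frac{2}{|V(G)|},$$ with equality if and only if $\widehat{\alpha}(I(M))=\frac{|V(G)|}{2}$. In particular, equality holds if $G$ is Hamiltonian, or if $G$ is regular with $\lambda(G)=\delta(G)$.
   Context: Graphs are finite. A graph is simple if it has no loops or parallel edges; it is $2$-connected if it is connected and remains connected after deletion of any vertex. The graphic matroid $M(G)$ is the matroid on the ground set $E(G)$ whose independent sets are the edge sets of acyclic subgraphs; its bases are the edge sets of spanning forests. Standing assumption: $\mathrm{rk}(M(G))<|E(G)|$ (i.e. $G$ contains a cycle). $G$ is Hamiltonian if it has a cycle through all vertices; regular if all vertices have the same degree; $\delta(G)$ is the minimum vertex degree; a bond is a minimal edge cut (an inclusion-minimal set of edges whose removal increases the number of connected components); $\lambda(G)$, the edge-connectivity, is the minimum size of a bond. Let $\mathbb{K}$ be a field. For a matroid $M$ on a finite ground set $E$, let $S=\mathbb{K}[x_e : e\in E]$ and define the facet ideal $I(M)=\langle \prod_{e\in B}x_e : B \text{ a basis of } M\rangle\subset S$. For a squarefree monomial ideal $I\subset S$, the $s$-th symbolic power is $I^{(s)}=\bigcap_{P\in \mathrm{Min}(I)}P^s$, where $\mathrm{Min}(I)$ is the set of minimal primes of $I$. Let $\alpha(I)$ be the least degree of a nonzero homogeneous element of $I$. The Waldschmidt constant is $\widehat{\alpha}(I)=\lim_{s\to\infty}\alpha(I^{(s)})/s$. The asymptotic resurgence is $\widehat{\rho}(I)=\sup\{s/r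 : s,r \text{ positive integers},\ I^{(st)}\not\subset I^{rt}\text{ for all } t\gg 0\}$. *)

theory Defs
  imports
    "HOL-Algebra.Ideal_Product"
    "HOL-Library.Poly_Mapping"
    "HOL-Library.Extended_Real"
begin

section \<open>Graphs\<close>

text \<open>Edges are two-element sets of vertices, which rules out loops and parallel edges.\<close>

definition simple_graph :: "'v set \<Rightarrow> 'v set set \<Rightarrow> bool" where
  "simple_graph V E \<longleftrightarrow> finite V \<and> (\<forall>e\<in>E. e \<subseteq> V \<and> card e = 2)"

definition connected_rel :: "'v set \<Rightarrow> 'v set set \<Rightarrow> ('v \<times> 'v) set" where
  "connected_rel V E = {(u, v). u \<in> V \<and> v \<in> V \<and> (u, v) \<in> {(x, y). {x, y} \<in> E}\<^sup>*}"

definition connected_graph :: "'v set \<Rightarrow> 'v set set \<Rightarrow> bool" where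
  "connected_graph V E \<longleftrightarrow> V \<noteq> {} \<and> (\<forall>u\<in>V. \<forall>v\<in>V. (u, v) \<in> connected_rel V E)"

definition two_connected :: "'v set \<Rightarrow> 'v set set \<Rightarrow> bool" where
  "two_connected V E \<longleftrightarrow>
     connected_graph V E \<and> (\<forall>v\<in>V. connected_graph (V - {v}) {e \<in> E. v \<notin> e})"

definition num_components :: "'v set \<Rightarrow> 'v set set \<Rightarrow> nat" where
  "num_components V E = card (V // connected_rel V E)"

text \<open>A cycle is given by the list of its vertices in cyclic order, without repetition of the
  starting vertex.\<close>

definition is_cycle :: "'v set set \<Rightarrow> 'v list \<Rightarrow> bool" where
  "is_cycle E c \<longleftrightarrow> length c \<ge> 3 \<and> distinct c \<and>
     (\<forall>i < length c. {c ! i, c ! (Suc i mod length c)} \<in> E)"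

definition acyclic_edges :: "'v set set \<Rightarrow> bool" where
  "acyclic_edges F \<longleftrightarrow> (\<nexists>c. is_cycle F c)"

definition hamiltonian :: "'v set \<Rightarrow> 'v set set \<Rightarrow> bool" where
  "hamiltonian V E \<longleftrightarrow> (\<exists>c. is_cycle E c \<and> set c = V)"

definition degree :: "'v set set \<Rightarrow> 'v \<Rightarrow> nat" where
  "degree E v = card {e \<in> E. v \<in> e}"

definition regular_graph :: "'v set \<Rightarrow> 'v set set \<Rightarrow> bool" where
  "regular_graph V E \<longleftrightarrow> (\<exists>d. \<forall>v\<in>V. degree E v = d)"

definition min_degree :: "'v set \<Rightarrow> 'v set set \<Rightarrow> nat" where
  "min_degree V E = Min (degree E ` V)"

definition edge_cut :: "'v set \<Rightarrow> 'v set set \<Rightarrow> 'v set set \<Rightarrow> bool" where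
  "edge_cut V E B \<longleftrightarrow> B \<subseteq> E \<and> num_components V (E - B) > num_components V E"

definition bond :: "'v set \<Rightarrow> 'v set set \<Rightarrow> 'v set set \<Rightarrow> bool" where
  "bond V E B \<longleftrightarrow> edge_cut V E B \<and> (\<forall>C. C \<subset> B \<longrightarrow> \<not> edge_cut V E C)"

definition edge_connectivity :: "'v set \<Rightarrow> 'v set set \<Rightarrow> nat" where
  "edge_connectivity V E = Min (card ` {B. bond V E B})"


section \<open>Matroids\<close>

text \<open>A matroid is represented by its ground set and its independence predicate.\<close>

type_synonym 'e matroid = "'e set \<times> ('e set \<Rightarrow> bool)"

definition ground :: "'e matroid \<Rightarrow> 'e set" where
  "ground M = fst M"

definition indep :: "'e matroid \<Rightarrow> 'e set \<Rightarrow> bool" where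
  "indep M X \<longleftrightarrow> X \<subseteq> ground M \<and> snd M X"

definition basis :: "'e matroid \<Rightarrow> 'e set \<Rightarrow> bool" where
  "basis M B \<longleftrightarrow> indep M B \<and> (\<forall>X. indep M X \<and> B \<subseteq> X \<longrightarrow> X = B)"

definition matroid_rank :: "'e matroid \<Rightarrow> nat" where
  "matroid_rank M = Max (card ` {X. indep M X})"

definition graphic_matroid :: "'v set set \<Rightarrow> 'v set matroid" where
  "graphic_matroid E = (E, acyclic_edges)"


section \<open>Polynomial rings\<close>

text \<open>A polynomial maps monomials to coefficients, and a monomial maps variables to exponents.
  The ring \<open>poly_ring E\<close> consists of the polynomials in which only variables
  \<open>x\<^sub>e\<close> with \<open>e \<in> E\<close> occur.\<close>

type_synonym ('e, 'k) mpoly = "('e \<Rightarrow>\<^sub>0 nat) \<Rightarrow>\<^sub>0 'k"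

definition poly_ring :: "'e set \<Rightarrow> ('e, 'k::field) mpoly ring" where
  "poly_ring E =
     \<lparr>carrier = {p. \<forall>m \<in> Poly_Mapping.keys p. Poly_Mapping.keys m \<subseteq> E},
      mult = (*), one = 1, zero = 0, add = (+)\<rparr>"

definition var :: "'e \<Rightarrow> ('e, 'k::field) mpoly" where
  "var e = Poly_Mapping.single (Poly_Mapping.single e 1) 1"

definition homogeneous :: "nat \<Rightarrow> ('e, 'k::field) mpoly \<Rightarrow> bool" where
  "homogeneous d p \<longleftrightarrow>
     (\<forall>m \<in> Poly_Mapping.keys p. (\<Sum>e\<in>Poly_Mapping.keys m. Poly_Mapping.lookup m e) = d)"

lemma cring_poly_ring: "cring (poly_ring E :: ('e, 'k::field) mpoly ring)"
proof -
  let ?R = "poly_ring E :: ('e, 'k) mpoly ring"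
  have add: "p + q \<in> carrier ?R" if "p \<in> carrier ?R" "q \<in> carrier ?R" for p q
    using that Poly_Mapping.keys_add[of p q] by (auto simp: poly_ring_def)
  have mult: "p * q \<in> carrier ?R" if p: "p \<in> carrier ?R" and q: "q \<in> carrier ?R" for p q
  proof -
    have "Poly_Mapping.keys m \<subseteq> E" if m: "m \<in> Poly_Mapping.keys (p * q)" for m
    proof -
      from m Poly_Mapping.keys_mult[of p q] obtain a b
        where ab: "m = a + b" "a \<in> Poly_Mapping.keys p" "b \<in> Poly_Mapping.keys q" by blast
      have "Poly_Mapping.keys a \<subseteq> E" "Poly_Mapping.keys b \<subseteq> E"
        using ab p q by (simp_all add: poly_ring_def)
      then show ?thesis using ab(1) Poly_Mapping.keys_add[of a b] by blast
    qed
    then show ?thesis by (auto simp: poly_ring_def)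
  qed
  have minus: "- p \<in> carrier ?R" if "p \<in> carrier ?R" for p
    using that by (auto simp: poly_ring_def Poly_Mapping.in_keys_iff)
  have one: "1 \<in> carrier ?R" and zero: "0 \<in> carrier ?R"
    by (simp_all add: poly_ring_def)
  have ops: "x \<oplus>\<^bsub>?R\<^esub> y = x + y" "x \<otimes>\<^bsub>?R\<^esub> y = x * y" "\<one>\<^bsub>?R\<^esub> = 1" "\<zero>\<^bsub>?R\<^esub> = 0" for x y
    by (simp_all add: poly_ring_def)
  show ?thesis
  proof (rule cringI)
    show "abelian_group ?R"
    proof (rule abelian_groupI)
      fix p assume "p \<in> carrier ?R"
      then show "\<exists>q \<in> carrier ?R. q \<oplus>\<^bsub>?R\<^esub> p = \<zero>\<^bsub>?R\<^esub>"
        using minus[of p] by (intro bexI[of _ "- p"]) (simp_all add: ops)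
    qed (simp_all add: ops add zero ac_simps)
    show "comm_monoid ?R"
      by (rule comm_monoidI) (simp_all add: ops mult one ac_simps)
  qed (simp add: ops distrib_right)
qed


section \<open>Facet ideals, symbolic powers and asymptotic invariants\<close>

definition facet_ideal :: "'e matroid \<Rightarrow> ('e, 'k::field) mpoly set" where
  "facet_ideal M = Idl\<^bsub>poly_ring (ground M)\<^esub> {\<Prod>e\<in>B. var e | B. basis M B}"

definition minimal_primes :: "('a, 'b) ring_scheme \<Rightarrow> 'a set \<Rightarrow> 'a set set" where
  "minimal_primes R I =
     {P. primeideal P R \<and> I \<subseteq> P \<and> (\<forall>Q. primeideal Q R \<and> I \<subseteq> Q \<and> Q \<subseteq> P \<longrightarrow> Q = P)}"

definition ideal_power :: "('a, 'b) ring_scheme \<Rightarrow> 'a set \<Rightarrow> nat \<Rightarrow> 'a set" where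
  "ideal_power R I n = I [^]\<^bsub>ideals_set R\<^esub> n"

definition symbolic_power :: "('a, 'b) ring_scheme \<Rightarrow> 'a set \<Rightarrow> nat \<Rightarrow> 'a set" where
  "symbolic_power R I s = {f \<in> carrier R. \<forall>P \<in> minimal_primes R I. f \<in> ideal_power R P s}"

definition initial_degree :: "('e, 'k::field) mpoly set \<Rightarrow> nat" where
  "initial_degree I = (LEAST d. \<exists>f \<in> I. f \<noteq> 0 \<and> homogeneous d f)"

definition waldschmidt :: "('e, 'k::field) mpoly ring \<Rightarrow> ('e, 'k) mpoly set \<Rightarrow> real" where
  "waldschmidt R I = lim (\<lambda>s. real (initial_degree (symbolic_power R I s)) / real s)"

text \<open>The supremum is taken in the extended reals, so that it is meaningful without a proof
  that the set is nonempty and bounded.\<close>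

definition asymptotic_resurgence :: "('a, 'b) ring_scheme \<Rightarrow> 'a set \<Rightarrow> ereal" where
  "asymptotic_resurgence R I =
     Sup {ereal (real s / real r) | s r. s > 0 \<and> r > 0 \<and>
       (\<forall>\<^sub>F t in sequentially. \<not> symbolic_power R I (s * t) \<subseteq> ideal_power R I (r * t))}"

end

theory Submission
  imports Defs "HOL-Library.Transitive_Closure_Table"
begin

text \<open>Let \<open>n\<close> be the number of vertices. Since \<open>I\<close>, its powers and its symbolic powers are spanned by
  monomials, both invariants are statements about exponent vectors, that is, nonnegative integer
  weights on the edges. The bases of the matroid are the spanning trees. A minimal prime of \<open>I\<close> is
  generated by the variables of a minimal set of edges that meets all spanning trees, and a set of
  edges meets all spanning trees iff it contains a cut. So a monomial lies in the \<open>s\<close>-th symbolic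
  power iff its exponent vector has weight at least \<open>s\<close> on every cut
  (\<open>symbolic_power_cover\<close>, \<open>transversal_trees_iff_cut\<close>), and it lies in the \<open>r\<close>-th power iff \<open>r\<close>
  spanning trees, with repetition, fit into its exponent vector.

  Upper bound. Suppose that the weight is at least \<open>s\<close> on every cut, and let \<open>F\<close> be a set of edges
  with \<open>c \<ge> 2\<close> components. In the sum of the weights of the cuts around these components, every
  edge outside \<open>F\<close> is counted at most twice, so the edges outside \<open>F\<close> have weight at
  least \<open>c * s / 2\<close> (\<open>components_weight_le\<close>). As \<open>c \<le> n\<close>, this is at least \<open>(c - 1) * s / K\<close> with
  \<open>K = 2 - 2 / n\<close>, which is the condition of Nash-Williams and Tutte for packing \<open>s / K\<close> spanning
  trees. A fractional packing suffices: it follows from Farkas' lemma and Kruskal's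
  algorithm (\<open>fractional_packing\<close>, \<open>tree_weight_le\<close>), and rounding it down loses no more than the
  number of spanning trees, which is negligible for the exponents \<open>s * t\<close> and \<open>r * t\<close> with large \<open>t\<close>
  (\<open>asymptotic_resurgence_le\<close>).

  Equality. By rounding, the Waldschmidt constant is the value of a linear program, the least
  total weight for which all cuts have weight at least 1 (\<open>waldschmidt_eq_cut_lp_value\<close>). Summing
  over the stars of the vertices shows that it is at least \<open>n / 2\<close>. If it is \<open>n / 2\<close>, then
  the symbolic powers contain elements of so small a degree that they cannot lie in the ordinary
  powers, whose nonzero elements have degree at least \<open>n - 1\<close> times the exponent
  (\<open>asymptotic_resurgence_lower\<close>). If it is larger, the estimate above improves for \<open>c = n\<close>, and
  for \<open>c < n\<close> it is better anyway (\<open>asymptotic_resurgence_strict\<close>). In the two special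
  cases an explicit weight attains \<open>n / 2\<close>: it is \<open>1 / 2\<close> on a Hamiltonian cycle, respectively
  constant.\<close>

section \<open>Monomial ideals\<close>

abbreviation keys :: "('a \<Rightarrow>\<^sub>0 'b::zero) \<Rightarrow> 'a set" where
  "keys \<equiv> Poly_Mapping.keys"

abbreviation lookup :: "('a \<Rightarrow>\<^sub>0 'b::zero) \<Rightarrow> 'a \<Rightarrow> 'b" where
  "lookup \<equiv> Poly_Mapping.lookup"

abbreviation single :: "'a \<Rightarrow> 'b \<Rightarrow> ('a \<Rightarrow>\<^sub>0 'b::zero)" where
  "single \<equiv> Poly_Mapping.single"

definition monomials :: "'e set \<Rightarrow> ('e \<Rightarrow>\<^sub>0 nat) set" where
  "monomials E = {m. keys m \<subseteq> E}"

text \<open>Every ideal below is spanned by the monomials that it contains, so that it is described by a set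
  of exponent vectors; the ring itself is the span of \<open>monomials E\<close>.\<close>

definition monomial_span :: "('e \<Rightarrow>\<^sub>0 nat) set \<Rightarrow> ('e, 'k::field) mpoly set" where
  "monomial_span A = {p. keys p \<subseteq> A}"

primrec monomial_power :: "'e set \<Rightarrow> ('e \<Rightarrow>\<^sub>0 nat) set \<Rightarrow> nat \<Rightarrow> ('e \<Rightarrow>\<^sub>0 nat) set" where
  "monomial_power E A 0 = monomials E"
| "monomial_power E A (Suc n) = {a + b | a b. a \<in> monomial_power E A n \<and> b \<in> A}"

lemma keys_add_nat: "keys (m + k :: 'e \<Rightarrow>\<^sub>0 nat) = keys m \<union> keys k"
  by (auto simp: in_keys_iff lookup_add)

lemma poly_ring_simps [simp]:
  "carrier (poly_ring E) = monomial_span (monomials E)"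
  "x \<otimes>\<^bsub>poly_ring E\<^esub> y = x * y" "x \<oplus>\<^bsub>poly_ring E\<^esub> y = x + y"
  "\<one>\<^bsub>poly_ring E\<^esub> = 1" "\<zero>\<^bsub>poly_ring E\<^esub> = 0"
  by (auto simp: poly_ring_def monomial_span_def monomials_def)

lemma poly_ring_a_inv:
  assumes "p \<in> monomial_span (monomials E)"
  shows "\<ominus>\<^bsub>poly_ring E\<^esub> p = (- p :: ('e, 'k::field) mpoly)"
proof -
  interpret cring "poly_ring E :: ('e, 'k) mpoly ring" by (rule cring_poly_ring)
  show ?thesis
    using minus_equality[of "- p" p] assms
    by (auto simp: monomial_span_def monomials_def in_keys_iff)
qed

lemma sum_of_monomials:
  fixes p :: "('e, 'k::field) mpoly"
  shows "p = (\<Sum>m\<in>keys p. single m (lookup p m))"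
  by (rule poly_mapping_eqI) (auto simp: lookup_sum lookup_single when_def in_keys_iff sum.delta)

lemma monomial_span_add:
  "p \<in> monomial_span A \<Longrightarrow> q \<in> monomial_span A \<Longrightarrow> p + q \<in> monomial_span A"
  using Poly_Mapping.keys_add[of p q] by (auto simp: monomial_span_def)

lemma single_in_monomial_span: "m \<in> A \<Longrightarrow> single m c \<in> monomial_span A"
  by (auto simp: monomial_span_def)

lemma monomial_span_induct [consumes 1, case_names zero single add]:
  fixes p :: "('e, 'k::field) mpoly"
  assumes "p \<in> monomial_span A"
    and zero: "Q 0"
    and single: "\<And>m c. m \<in> A \<Longrightarrow> Q (single m c)"
    and add: "\<And>p q. Q p \<Longrightarrow> Q q \<Longrightarrow> Q (p + q)"
  shows "Q p"
proof -
  have "Q (\<Sum>m\<in>S. single m (lookup p m))" if "finite S" "S \<subseteq> A" for S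
    using that by (induction S) (auto intro: zero single add)
  then have "Q (\<Sum>m\<in>keys p. single m (lookup p m))"
    using assms(1) by (simp add: monomial_span_def)
  then show ?thesis
    using sum_of_monomials[of p] by simp
qed

lemma ideal_monomial_span:
  assumes A: "A \<subseteq> monomials E"
    and up: "\<And>a b. a \<in> A \<Longrightarrow> b \<in> monomials E \<Longrightarrow> a + b \<in> A"
  shows "ideal (monomial_span A) (poly_ring E :: ('e, 'k::field) mpoly ring)"
proof -
  interpret cring "poly_ring E :: ('e, 'k) mpoly ring" by (rule cring_poly_ring)
  have mult: "p * q \<in> monomial_span A"
    if "p \<in> monomial_span A" "q \<in> monomial_span (monomials E)" for p q :: "('e, 'k) mpoly"
    using that keys_mult[of p q] up unfolding monomial_span_def by blast
  have sub: "monomial_span A \<subseteq> (monomial_span (monomials E) :: ('e, 'k) mpoly set)"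
    using A by (auto simp: monomial_span_def)
  show ?thesis
  proof (rule idealI)
    show "subgroup (monomial_span A) (add_monoid (poly_ring E :: ('e, 'k) mpoly ring))"
    proof (rule add.subgroupI)
      show "monomial_span A \<subseteq> carrier (poly_ring E :: ('e, 'k) mpoly ring)"
        using sub by simp
      have "0 \<in> (monomial_span A :: ('e, 'k) mpoly set)" by (simp add: monomial_span_def)
      then show "(monomial_span A :: ('e, 'k) mpoly set) \<noteq> {}" by blast
    next
      fix p :: "('e, 'k) mpoly" assume p: "p \<in> monomial_span A"
      then have "\<ominus>\<^bsub>poly_ring E\<^esub> p = - p" using sub by (intro poly_ring_a_inv) blast
      moreover have "- p \<in> monomial_span A"
        using p by (auto simp: monomial_span_def in_keys_iff)
      ultimately show "\<ominus>\<^bsub>poly_ring E\<^esub> p \<in> monomial_span A" by simp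
    qed (simp add: monomial_span_add)
  qed (use mult in \<open>auto simp: mult.commute ring_axioms\<close>)
qed

text \<open>A monomial of a product of polynomials is a product of their monomials; conversely a term with
  exponent \<open>a + b\<close> factors into terms with exponents \<open>a\<close> and \<open>b\<close>. Hence products and powers
  of monomial ideals are computed on exponent vectors.\<close>

lemma ideal_prod_monomial_span:
  "ideal_prod (poly_ring E) (monomial_span A) (monomial_span B) =
     (monomial_span {a + b | a b. a \<in> A \<and> b \<in> B} :: ('e, 'k::field) mpoly set)"
    (is "?L = ?R")
proof
  show "?L \<subseteq> ?R"
  proof
    fix p assume "p \<in> ?L"
    then show "p \<in> ?R"
    proof induction
      case (prod i j)
      then show ?case using keys_mult[of i j] by (fastforce simp: monomial_span_def)
    qed (simp add: monomial_span_add)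
  qed
next
  show "?R \<subseteq> ?L"
  proof
    fix p :: "('e, 'k) mpoly" assume "p \<in> ?R"
    then show "p \<in> ?L"
    proof (induction rule: monomial_span_induct)
      case zero
      show ?case
        using ideal_prod.prod[of 0 "monomial_span A :: ('e, 'k) mpoly set" 0 "monomial_span B" "poly_ring E"]
        by (simp add: monomial_span_def)
    next
      case (single m c)
      then obtain a b where "m = a + b" "a \<in> A" "b \<in> B" by blast
      then show ?case
        using ideal_prod.prod[of "single a c" "monomial_span A :: ('e, 'k) mpoly set" "single b 1" "monomial_span B" "poly_ring E"]
        by (simp add: single_in_monomial_span mult_single)
    next
      case (add p q)
      then show ?case using ideal_prod.sum[of p "poly_ring E" _ _ q] by simp
    qed
  qed
qed

lemma ideal_power_monomial_span:
  "ideal_power (poly_ring E) (monomial_span A) n =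
     (monomial_span (monomial_power E A n) :: ('e, 'k::field) mpoly set)"
  by (induction n)
    (simp_all add: ideal_power_def ideals_set_def nat_pow_def ideal_prod_monomial_span)

definition indicator_mon :: "'e set \<Rightarrow> ('e \<Rightarrow>\<^sub>0 nat)" where
  "indicator_mon B = (\<Sum>e\<in>B. single e 1)"

lemma lookup_indicator_mon:
  "finite B \<Longrightarrow> lookup (indicator_mon B) e = (if e \<in> B then 1 else 0)"
  by (simp add: indicator_mon_def lookup_sum lookup_single when_def sum.delta)

lemma keys_indicator_mon: "finite B \<Longrightarrow> keys (indicator_mon B) = B"
  by (auto simp: in_keys_iff lookup_indicator_mon split: if_splits)

lemma prod_var: "finite B \<Longrightarrow> (\<Prod>e\<in>B. var e) = (single (indicator_mon B) 1 :: ('e, 'k::field) mpoly)"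
  by (induction B rule: finite_induct) (auto simp: indicator_mon_def var_def mult_single)

text \<open>The exponent vectors of the ideal generated by the squarefree monomials with supports in
  \<open>\<B>\<close>.\<close>

definition cover_monomials :: "'e set \<Rightarrow> 'e set set \<Rightarrow> ('e \<Rightarrow>\<^sub>0 nat) set" where
  "cover_monomials E \<B> = {m \<in> monomials E. \<exists>B\<in>\<B>. B \<subseteq> keys m}"

lemma diff_indicator_mon:
  assumes "finite B" "B \<subseteq> keys m"
  shows "(m - indicator_mon B) + indicator_mon B = m"
  by (rule poly_mapping_eqI)
    (use assms in \<open>auto simp: lookup_add lookup_minus lookup_indicator_mon in_keys_iff\<close>)

lemma cover_monomials_up:
  "a \<in> cover_monomials E \<B> \<Longrightarrow> b \<in> monomials E \<Longrightarrow> a + b \<in> cover_monomials E \<B>"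
  by (auto simp: cover_monomials_def monomials_def keys_add_nat)

lemma ideal_cover_monomials:
  "ideal (monomial_span (cover_monomials E \<B>)) (poly_ring E :: ('e, 'k::field) mpoly ring)"
  by (rule ideal_monomial_span) (auto simp: cover_monomials_up, simp add: cover_monomials_def)

lemma Idl_squarefree:
  assumes "finite E" "\<And>B. B \<in> \<B> \<Longrightarrow> B \<subseteq> E"
  shows "Idl\<^bsub>poly_ring E\<^esub> {\<Prod>e\<in>B. var e | B. B \<in> \<B>} =
    (monomial_span (cover_monomials E \<B>) :: ('e, 'k::field) mpoly set)" (is "Idl\<^bsub>_\<^esub> ?G = ?R")
proof -
  interpret cring "poly_ring E :: ('e, 'k) mpoly ring" by (rule cring_poly_ring)
  have fin: "finite B" if "B \<in> \<B>" for B
    using assms that finite_subset by blast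
  have gen: "(\<Prod>e\<in>B. var e) = (single (indicator_mon B) 1 :: ('e, 'k) mpoly)" if "B \<in> \<B>" for B
    by (rule prod_var[OF fin[OF that]])
  have GR: "?G \<subseteq> ?R"
    using assms fin by (fastforce simp: prod_var monomial_span_def cover_monomials_def monomials_def
        keys_indicator_mon)
  have "?R \<subseteq> carrier (poly_ring E)"
    by (auto simp: monomial_span_def cover_monomials_def)
  with GR have G: "?G \<subseteq> carrier (poly_ring E)" by blast
  have id: "ideal (Idl\<^bsub>poly_ring E\<^esub> ?G) (poly_ring E)" by (rule genideal_ideal[OF G])
  have "?R \<subseteq> Idl\<^bsub>poly_ring E\<^esub> ?G"
  proof
    fix p :: "('e, 'k) mpoly" assume "p \<in> ?R"
    then show "p \<in> Idl\<^bsub>poly_ring E\<^esub> ?G"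
    proof (induction rule: monomial_span_induct)
      case zero
      show ?case using additive_subgroup.zero_closed[OF ideal.axioms(1)[OF id]] by simp
    next
      case (single m c)
      then obtain B where B: "B \<in> \<B>" "B \<subseteq> keys m" and m: "m \<in> monomials E"
        by (auto simp: cover_monomials_def)
      have eq: "single m c = single (m - indicator_mon B) c * (\<Prod>e\<in>B. var e)"
        using diff_indicator_mon[OF fin[OF B(1)] B(2)] by (simp add: gen B mult_single)
      have "(\<Prod>e\<in>B. var e) \<in> Idl\<^bsub>poly_ring E\<^esub> ?G"
        using genideal_self[OF G] B by blast
      moreover have "m - indicator_mon B \<in> monomials E"
        using m by (fastforce simp: monomials_def in_keys_iff lookup_minus)
      ultimately show ?case
        unfolding eq using ideal.I_l_closed[OF id, of "\<Prod>e\<in>B. var e" "single (m - indicator_mon B) c"]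
        by (simp add: single_in_monomial_span)
    next
      case (add p q)
      then show ?case using additive_subgroup.a_closed[OF ideal.axioms(1)[OF id]] by simp
    qed
  qed
  moreover have "Idl\<^bsub>poly_ring E\<^esub> ?G \<subseteq> ?R"
    by (rule genideal_minimal[OF ideal_cover_monomials GR])
  ultimately show ?thesis by blast
qed

lemma facet_ideal_eq:
  assumes "finite (ground M)"
  shows "facet_ideal M =
    (monomial_span (cover_monomials (ground M) {B. basis M B}) :: ('e, 'k::field) mpoly set)"
proof -
  have "B \<subseteq> ground M" if "basis M B" for B
    using that by (auto simp: basis_def indep_def)
  then show ?thesis
    using Idl_squarefree[OF assms, of "{B. basis M B}"] by (simp add: facet_ideal_def)
qed

section \<open>Symbolic powers of squarefree monomial ideals\<close>

text \<open>The ideal generated by the variables \<open>x\<^sub>e\<close> with \<open>e \<in> C\<close>.\<close>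

definition variable_ideal :: "'e set \<Rightarrow> 'e set \<Rightarrow> ('e, 'k::field) mpoly set" where
  "variable_ideal E C = monomial_span {m \<in> monomials E. keys m \<inter> C \<noteq> {}}"

text \<open>An additive map into exponent vectors over the natural numbers, injective on the monomials in
  \<open>E\<close> if \<open>h\<close> is injective on \<open>E\<close>. It pulls back the lexicographic order, and thereby supplies a
  monomial order although the variables carry no order.\<close>

definition encode_mon :: "('e \<Rightarrow> nat) \<Rightarrow> 'e set \<Rightarrow> ('e \<Rightarrow>\<^sub>0 nat) \<Rightarrow> (nat \<Rightarrow>\<^sub>0 nat)" where
  "encode_mon h E m = (\<Sum>e\<in>E. single (h e) (lookup m e))"

lemma encode_mon_add: "encode_mon h E (a + b) = encode_mon h E a + encode_mon h E b"
  by (simp add: encode_mon_def lookup_add single_add sum.distrib)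

lemma encode_mon_inj:
  assumes "finite E" "inj_on h E" "a \<in> monomials E" "b \<in> monomials E"
    and eq: "encode_mon h E a = encode_mon h E b"
  shows "a = b"
proof (rule poly_mapping_eqI)
  have lk: "lookup (encode_mon h E m) (h e) = lookup m e" if "e \<in> E" for m e
  proof -
    have "lookup (encode_mon h E m) (h e) = (\<Sum>x\<in>E. if x = e then lookup m x else 0)"
      unfolding encode_mon_def lookup_sum
      by (rule sum.cong) (use that assms(2) in \<open>auto simp: lookup_single when_def dest: inj_onD\<close>)
    then show ?thesis using that assms(1) by simp
  qed
  fix e show "lookup a e = lookup b e"
  proof (cases "e \<in> E")
    case True
    then show ?thesis using lk[of e a] lk[of e b] eq by simp
  next
    case False
    then have "e \<notin> keys a" "e \<notin> keys b" using assms(3,4) by (auto simp: monomials_def)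
    then show ?thesis by (simp add: in_keys_iff)
  qed
qed

text \<open>If neither factor lies in the ideal, both have terms without variables from \<open>C\<close>. The product
  of the leading ones among these terms (for the monomial order given by \<open>encode_mon\<close>)
  arises in only one way from terms of the two factors, hence does not cancel, and it avoids
  \<open>C\<close> too.\<close>

lemma primeideal_variable_ideal:
  assumes E: "finite E"
  shows "primeideal (variable_ideal E C) (poly_ring E :: ('e, 'k::field) mpoly ring)"
proof (rule primeidealI)
  let ?A = "{m \<in> monomials E. keys m \<inter> C \<noteq> {}}"
  show "ideal (variable_ideal E C) (poly_ring E :: ('e, 'k) mpoly ring)"
    unfolding variable_ideal_def
    by (rule ideal_monomial_span) (auto simp: monomials_def keys_add_nat)
  show "cring (poly_ring E :: ('e, 'k) mpoly ring)" by (rule cring_poly_ring)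
  have "1 \<in> (monomial_span (monomials E) :: ('e, 'k) mpoly set)"
    "1 \<notin> (variable_ideal E C :: ('e, 'k) mpoly set)"
    by (auto simp: monomial_span_def monomials_def variable_ideal_def)
  then show "carrier (poly_ring E :: ('e, 'k) mpoly ring) \<noteq> variable_ideal E C" by auto
next
  fix p q :: "('e, 'k) mpoly"
  assume pq: "p \<in> carrier (poly_ring E)" "q \<in> carrier (poly_ring E)"
    and prod: "p \<otimes>\<^bsub>poly_ring E\<^esub> q \<in> variable_ideal E C"
  obtain h :: "'e \<Rightarrow> nat" where h: "inj_on h E"
    using finite_imp_inj_to_nat_seg[OF E] by blast
  let ?f = "encode_mon h E"
  have leading: "\<exists>m\<in>keys r. keys m \<inter> C = {} \<and>
      (\<forall>k\<in>keys r. keys k \<inter> C = {} \<longrightarrow> k \<noteq> m \<longrightarrow> ?f k < ?f m)"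
    if "r \<in> carrier (poly_ring E)" "r \<notin> variable_ideal E C" for r :: "('e, 'k) mpoly"
  proof -
    let ?K = "{k \<in> keys r. keys k \<inter> C = {}}"
    have "?K \<noteq> {}"
      using that by (auto simp: variable_ideal_def monomial_span_def)
    moreover have "finite ?K" by simp
    ultimately have "Max (?f ` ?K) \<in> ?f ` ?K" by (intro Max_in) auto
    then obtain m where m: "m \<in> ?K" "?f m = Max (?f ` ?K)" by auto
    have "?f k < ?f m" if k: "k \<in> ?K" "k \<noteq> m" for k
    proof -
      have "?f k \<le> ?f m" using m(2) k(1) by simp
      moreover have "?f k \<noteq> ?f m"
        using encode_mon_inj[OF E h, of k m] k m \<open>r \<in> carrier (poly_ring E)\<close>
        by (auto simp: monomial_span_def)
      ultimately show ?thesis by simp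
    qed
    with m(1) show ?thesis by auto
  qed
  show "p \<in> variable_ideal E C \<or> q \<in> variable_ideal E C"
  proof (rule ccontr)
    assume "\<not> ?thesis"
    then obtain a b where a: "a \<in> keys p" "keys a \<inter> C = {}"
        "\<And>k. k \<in> keys p \<Longrightarrow> keys k \<inter> C = {} \<Longrightarrow> k \<noteq> a \<Longrightarrow> ?f k < ?f a"
      and b: "b \<in> keys q" "keys b \<inter> C = {}"
        "\<And>k. k \<in> keys q \<Longrightarrow> keys k \<inter> C = {} \<Longrightarrow> k \<noteq> b \<Longrightarrow> ?f k < ?f b"
      using leading pq by metis
    have unique: "k = a \<and> l = b" if "k \<in> keys p" "l \<in> keys q" "k + l = a + b" for k l
    proof -
      have "keys k \<inter> C = {}" "keys l \<inter> C = {}"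
        using a(2) b(2) that(3) keys_add_nat[of k l] keys_add_nat[of a b] by auto
      moreover have "?f k + ?f l = ?f a + ?f b"
        using that(3) by (metis encode_mon_add)
      moreover have "?f k + ?f l < ?f a + ?f b" if "?f k < ?f a" "?f l < ?f b"
        using that by (rule add_strict_mono)
      ultimately show ?thesis
        using a(3)[of k] b(3)[of l] that
        by (metis add_left_cancel add_right_cancel less_irrefl)
    qed
    define p' where "p' = p - single a (lookup p a)"
    define q' where "q' = q - single b (lookup q b)"
    have p': "keys p' \<subseteq> keys p - {a}" and q': "keys q' \<subseteq> keys q - {b}"
      by (auto simp: p'_def q'_def in_keys_iff lookup_minus lookup_single when_def split: if_splits)
    have "p * q = single (a + b) (lookup p a * lookup q b) + single a (lookup p a) * q' + p' * q"
      by (simp add: p'_def q'_def algebra_simps flip: mult_single)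
    moreover have "a + b \<notin> keys (single a (lookup p a) * q')"
      using keys_mult[of "single a (lookup p a)" q'] q' unique a(1) by (fastforce split: if_splits)
    moreover have "a + b \<notin> keys (p' * q)"
      using keys_mult[of p' q] p' unique by fastforce
    ultimately have "lookup (p * q) (a + b) = lookup p a * lookup q b"
      by (simp add: lookup_add in_keys_iff)
    then have "a + b \<in> keys (p * q)"
      using a(1) b(1) by (simp add: in_keys_iff)
    then have "keys (a + b) \<inter> C \<noteq> {}"
      using prod by (auto simp: variable_ideal_def monomial_span_def)
    then show False
      using a(2) b(2) by (auto simp: keys_add_nat)
  qed
qed

text \<open>A monomial of degree at least \<open>s + 1\<close> in the variables from \<open>C\<close> is divisible by one of them,
  and the quotient still has degree at least \<open>s\<close> in these variables.\<close>

lemma monomial_power_variables: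
  assumes E: "finite E" and C: "C \<subseteq> E"
  shows "monomial_power E {m \<in> monomials E. keys m \<inter> C \<noteq> {}} s =
    {m \<in> monomials E. s \<le> (\<Sum>e\<in>C. lookup m e)}"
proof (induction s)
  case (Suc s)
  have fC: "finite C" using E C by (rule rev_finite_subset)
  show ?case
  proof (intro equalityI subsetI)
    fix m assume "m \<in> monomial_power E {m \<in> monomials E. keys m \<inter> C \<noteq> {}} (Suc s)"
    then obtain a b where m: "m = a + b" "a \<in> monomials E" "b \<in> monomials E"
        "s \<le> (\<Sum>e\<in>C. lookup a e)" "keys b \<inter> C \<noteq> {}"
      using Suc.IH by auto
    then obtain e where "e \<in> C" "lookup b e > 0" by (auto simp: in_keys_iff)
    then have "0 < (\<Sum>e\<in>C. lookup b e)" using fC by (intro sum_pos2) auto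
    then show "m \<in> {m \<in> monomials E. Suc s \<le> (\<Sum>e\<in>C. lookup m e)}"
      using m by (auto simp: monomials_def keys_add_nat lookup_add sum.distrib)
  next
    fix m assume "m \<in> {m \<in> monomials E. Suc s \<le> (\<Sum>e\<in>C. lookup m e)}"
    then have m: "m \<in> monomials E" "Suc s \<le> (\<Sum>e\<in>C. lookup m e)" by auto
    then have "(\<Sum>e\<in>C. lookup m e) \<noteq> 0" by simp
    then obtain e where e: "e \<in> C" "lookup m e \<noteq> 0" by (auto simp: fC)
    define b where "b = indicator_mon {e}"
    have eq: "(m - b) + b = m"
      unfolding b_def using e by (intro diff_indicator_mon) (auto simp: in_keys_iff)
    have "(\<Sum>x\<in>C. lookup b x) = 1"
      using e fC by (simp add: b_def lookup_indicator_mon sum.delta)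
    then have "s \<le> (\<Sum>x\<in>C. lookup (m - b) x)"
      using m(2) arg_cong[OF eq, of "\<lambda>m. \<Sum>x\<in>C. lookup m x"] by (simp add: lookup_add sum.distrib)
    moreover have "m - b \<in> monomials E" "b \<in> monomials E"
      using m(1) keys_add_nat[of "m - b" b] eq by (auto simp: monomials_def)
    moreover have "keys b \<inter> C \<noteq> {}" using e by (simp add: b_def keys_indicator_mon)
    ultimately show "m \<in> monomial_power E {m \<in> monomials E. keys m \<inter> C \<noteq> {}} (Suc s)"
      unfolding monomial_power.simps Suc.IH mem_Collect_eq
      using eq by (intro exI[of _ "m - b"] exI[of _ b]) simp
  qed
qed simp

definition transversal :: "'e set set \<Rightarrow> 'e set \<Rightarrow> bool" where
  "transversal \<B> C \<longleftrightarrow> (\<forall>B\<in>\<B>. B \<inter> C \<noteq> {})"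

lemma cover_subset_variable_ideal:
  assumes "transversal \<B> C"
  shows "monomial_span (cover_monomials E \<B>) \<subseteq> variable_ideal E C"
proof -
  have "cover_monomials E \<B> \<subseteq> {m \<in> monomials E. keys m \<inter> C \<noteq> {}}"
    using assms by (auto simp: transversal_def cover_monomials_def)
  then show ?thesis unfolding monomial_span_def variable_ideal_def by blast
qed

lemma var_in_monomial_span_iff:
  "(var e :: ('e, 'k::field) mpoly) \<in> monomial_span A \<longleftrightarrow> single e 1 \<in> A"
  by (simp add: var_def monomial_span_def)

text \<open>A prime ideal containing the product of the variables in \<open>B\<close> contains one of these
  variables.\<close>

lemma prime_contains_variable_ideal:
  assumes P: "primeideal P (poly_ring E :: ('e, 'k::field) mpoly ring)"
    and sub: "monomial_span (cover_monomials E \<B>) \<subseteq> P"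
    and E: "finite E" "\<And>B. B \<in> \<B> \<Longrightarrow> B \<subseteq> E"
  defines "C \<equiv> {e \<in> E. var e \<in> P}"
  shows "transversal \<B> C \<and> variable_ideal E C \<subseteq> P"
proof
  interpret primeideal P "poly_ring E :: ('e, 'k) mpoly ring" by (rule P)
  have varE: "(var e :: ('e, 'k) mpoly) \<in> carrier (poly_ring E)" if "e \<in> E" for e
    using that by (simp add: var_in_monomial_span_iff monomials_def)
  have one: "1 \<notin> P"
  proof
    assume "1 \<in> P"
    then have "P = carrier (poly_ring E :: ('e, 'k) mpoly ring)" using one_imp_carrier by simp
    with I_notcarr show False by blast
  qed
  show "transversal \<B> C"
    unfolding transversal_def
  proof
    fix B assume B: "B \<in> \<B>"
    have fB: "finite B" using E B finite_subset by blast
    have "\<exists>e\<in>F. var e \<in> P" if "finite F" "F \<subseteq> E" "(\<Prod>e\<in>F. var e) \<in> P" for F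
      using that
    proof (induction F)
      case (insert x F)
      have "(\<Prod>e\<in>F. var e) \<in> carrier (poly_ring E)"
        using insert.prems insert.hyps
        by (simp add: prod_var monomial_span_def monomials_def keys_indicator_mon)
      then show ?case
        using I_prime[of "var x" "\<Prod>e\<in>F. var e"] varE[of x] insert by auto
    qed (use one in simp)
    moreover have "indicator_mon B \<in> cover_monomials E \<B>"
      using E(2)[OF B] B by (auto simp: cover_monomials_def monomials_def keys_indicator_mon[OF fB])
    then have "(\<Prod>e\<in>B. var e) \<in> P"
      using sub by (simp add: prod_var[OF fB] subsetD single_in_monomial_span)
    ultimately show "B \<inter> C \<noteq> {}"
      using fB E(2)[OF B] by (auto simp: C_def)
  qed
  show "variable_ideal E C \<subseteq> P"
  proof
    fix p :: "('e, 'k) mpoly" assume "p \<in> variable_ideal E C"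
    then show "p \<in> P"
      unfolding variable_ideal_def
    proof (induction rule: monomial_span_induct)
      case (single m c)
      then obtain e where e: "e \<in> keys m" "e \<in> C" and m: "m \<in> monomials E" by auto
      have "single m c = single (m - indicator_mon {e}) c * var e"
        using diff_indicator_mon[of "{e}" m] e
        by (simp add: var_def mult_single indicator_mon_def)
      moreover have "m - indicator_mon {e} \<in> monomials E"
        using m by (fastforce simp: monomials_def in_keys_iff lookup_minus)
      ultimately show ?case
        using I_l_closed[of "var e" "single (m - indicator_mon {e}) c"] e(2)
        by (simp add: C_def single_in_monomial_span)
    qed (use additive_subgroup.zero_closed[OF is_additive_subgroup]
      additive_subgroup.a_closed[OF is_additive_subgroup] in auto)
  qed
qed

text \<open>These two facts replace a list of the minimal primes: all of them come from transversals, and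
  below every transversal there is one that yields a minimal prime. This suffices for
  intersecting their powers, since \<open>variable_ideal E D\<close> grows with \<open>D\<close>.\<close>

lemma minimal_primes_cover:
  fixes E :: "'e set" and \<B> :: "'e set set"
  assumes E: "finite E" "\<And>B. B \<in> \<B> \<Longrightarrow> B \<subseteq> E"
  defines "R \<equiv> (poly_ring E :: ('e, 'k::field) mpoly ring)"
    and "I \<equiv> (monomial_span (cover_monomials E \<B>) :: ('e, 'k) mpoly set)"
  shows "P \<in> minimal_primes R I \<Longrightarrow> \<exists>C\<subseteq>E. transversal \<B> C \<and> P = variable_ideal E C"
    and "\<And>C. C \<subseteq> E \<Longrightarrow> transversal \<B> C \<Longrightarrow>
      \<exists>D\<subseteq>C. variable_ideal E D \<in> minimal_primes R I"
proof -
  show "\<exists>C\<subseteq>E. transversal \<B> C \<and> P = variable_ideal E C" if P: "P \<in> minimal_primes R I"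
  proof -
    let ?C = "{e \<in> E. var e \<in> P}"
    have pr: "primeideal P R" "I \<subseteq> P" using P by (auto simp: minimal_primes_def)
    have *: "transversal \<B> ?C" "variable_ideal E ?C \<subseteq> P"
      using prime_contains_variable_ideal[OF pr[unfolded R_def I_def] E] by auto
    have "P = variable_ideal E ?C"
      using P * cover_subset_variable_ideal[OF *(1)] primeideal_variable_ideal[OF E(1)]
      unfolding minimal_primes_def R_def I_def by blast
    with * show ?thesis by (intro exI[of _ ?C]) auto
  qed
  fix C assume C: "C \<subseteq> E" "transversal \<B> C"
  define \<T> where "\<T> = {D. D \<subseteq> C \<and> transversal \<B> D}"
  have "finite \<T>" "C \<in> \<T>"
    using finite_subset[OF C(1) E(1)] C by (simp_all add: \<T>_def)
  from finite_has_minimal2[OF this] obtain D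
    where D': "D \<in> \<T>" and Dmin: "\<And>D'. D' \<in> \<T> \<Longrightarrow> D' \<subseteq> D \<Longrightarrow> D = D'" by blast
  then have D: "D \<subseteq> C" "transversal \<B> D" by (simp_all add: \<T>_def)
  have "variable_ideal E D \<in> minimal_primes R I"
    unfolding minimal_primes_def
  proof (intro CollectI conjI allI impI)
    show "primeideal (variable_ideal E D) R"
      unfolding R_def by (rule primeideal_variable_ideal[OF E(1)])
    show "I \<subseteq> variable_ideal E D"
      unfolding I_def by (rule cover_subset_variable_ideal[OF D(2)])
    fix Q assume Q: "primeideal Q R \<and> I \<subseteq> Q \<and> Q \<subseteq> variable_ideal E D"
    let ?C = "{e \<in> E. var e \<in> Q}"
    have *: "transversal \<B> ?C" "variable_ideal E ?C \<subseteq> Q"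
      using prime_contains_variable_ideal[OF _ _ E] Q unfolding R_def I_def by blast+
    have "?C \<subseteq> D"
    proof
      fix e assume "e \<in> ?C"
      then have "(var e :: ('e, 'k) mpoly) \<in> variable_ideal E D" using Q by blast
      then show "e \<in> D" by (auto simp: variable_ideal_def var_in_monomial_span_iff)
    qed
    moreover have "?C \<in> \<T>"
      using * D(1) \<open>?C \<subseteq> D\<close> by (simp add: \<T>_def)
    ultimately have "D = ?C" by (intro Dmin)
    with * have "variable_ideal E D \<subseteq> Q" by simp
    with Q show "Q = variable_ideal E D" by blast
  qed
  with D show "\<exists>D\<subseteq>C. variable_ideal E D \<in> minimal_primes R I" by blast
qed

lemma symbolic_power_cover:
  assumes E: "finite E" "\<And>B. B \<in> \<B> \<Longrightarrow> B \<subseteq> E"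
  shows "symbolic_power (poly_ring E) (monomial_span (cover_monomials E \<B>)) s =
    (monomial_span {m \<in> monomials E. \<forall>C\<subseteq>E. transversal \<B> C \<longrightarrow> s \<le> (\<Sum>e\<in>C. lookup m e)}
      :: ('e, 'k::field) mpoly set)" (is "?L = ?R")
proof -
  let ?I = "monomial_span (cover_monomials E \<B>) :: ('e, 'k) mpoly set"
  let ?MP = "minimal_primes (poly_ring E :: ('e, 'k) mpoly ring) ?I"
  have power: "ideal_power (poly_ring E) (variable_ideal E C) s =
      (monomial_span {m \<in> monomials E. s \<le> (\<Sum>e\<in>C. lookup m e)} :: ('e, 'k) mpoly set)"
    if "C \<subseteq> E" for C
    unfolding variable_ideal_def ideal_power_monomial_span monomial_power_variables[OF E(1) that] ..
  show ?thesis
  proof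
    show "?L \<subseteq> ?R"
    proof
      fix f :: "('e, 'k) mpoly" assume f: "f \<in> ?L"
      show "f \<in> ?R"
        unfolding monomial_span_def
      proof (intro CollectI subsetI conjI allI impI)
        fix m assume m: "m \<in> keys f"
        show "m \<in> monomials E"
          using f m by (auto simp: symbolic_power_def monomial_span_def)
        fix C assume C: "C \<subseteq> E" "transversal \<B> C"
        obtain D where D: "D \<subseteq> C" "variable_ideal E D \<in> ?MP"
          using minimal_primes_cover(2)[OF E C] by blast
        then have "f \<in> ideal_power (poly_ring E) (variable_ideal E D) s"
          using f by (auto simp: symbolic_power_def)
        then have "s \<le> (\<Sum>e\<in>D. lookup m e)"
          using power[of D] D(1) C(1) m by (auto simp: monomial_span_def)
        also have "\<dots> \<le> (\<Sum>e\<in>C. lookup m e)"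
          using D(1) finite_subset[OF C(1) E(1)] by (intro sum_mono2) auto
        finally show "s \<le> (\<Sum>e\<in>C. lookup m e)" .
      qed
    qed
    show "?R \<subseteq> ?L"
    proof
      fix f :: "('e, 'k) mpoly" assume f: "f \<in> ?R"
      show "f \<in> ?L"
        unfolding symbolic_power_def
      proof (intro CollectI conjI ballI)
        show "f \<in> carrier (poly_ring E)" using f by (auto simp: monomial_span_def)
        fix P assume "P \<in> ?MP"
        then obtain C where C: "C \<subseteq> E" "transversal \<B> C" "P = variable_ideal E C"
          using minimal_primes_cover(1)[OF E] by blast
        then show "f \<in> ideal_power (poly_ring E) P s"
          using f power[of C] by (auto simp: monomial_span_def)
      qed
    qed
  qed
qed

section \<open>Degrees and packings\<close>

definition mon_degree :: "('e \<Rightarrow>\<^sub>0 nat) \<Rightarrow> nat" where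
  "mon_degree m = (\<Sum>e\<in>keys m. lookup m e)"

lemma mon_degree_eq_sum:
  assumes "finite E" "m \<in> monomials E"
  shows "mon_degree m = (\<Sum>e\<in>E. lookup m e)"
  unfolding mon_degree_def
  by (rule sum.mono_neutral_left) (use assms in \<open>auto simp: monomials_def in_keys_iff\<close>)

lemma initial_degree_le:
  assumes "m \<in> A"
  shows "initial_degree (monomial_span A :: ('e, 'k::field) mpoly set) \<le> mon_degree m"
  unfolding initial_degree_def
proof (rule Least_le)
  show "\<exists>f\<in>monomial_span A. f \<noteq> 0 \<and> homogeneous (mon_degree m) (f :: ('e, 'k) mpoly)"
    by (rule bexI[of _ "single m 1"])
      (use assms in \<open>auto simp: homogeneous_def mon_degree_def single_in_monomial_span
        poly_mapping_eq_iff fun_eq_iff lookup_single when_def\<close>)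
qed

lemma initial_degree_attained:
  assumes "A \<noteq> {}"
  obtains m where "m \<in> A"
    "initial_degree (monomial_span A :: ('e, 'k::field) mpoly set) = mon_degree m"
proof -
  define I where "I = (monomial_span A :: ('e, 'k) mpoly set)"
  obtain k where k: "k \<in> A" using assms by blast
  have "\<exists>f\<in>I. f \<noteq> 0 \<and> homogeneous (mon_degree k) f"
    unfolding I_def
    by (rule bexI[of _ "single k 1"])
      (use k in \<open>auto simp: homogeneous_def mon_degree_def single_in_monomial_span
        poly_mapping_eq_iff fun_eq_iff lookup_single when_def\<close>)
  then have "\<exists>f\<in>I. f \<noteq> 0 \<and> homogeneous (initial_degree I) f"
    unfolding initial_degree_def by (rule LeastI)
  then obtain f where f: "f \<in> I" "f \<noteq> 0" "homogeneous (initial_degree I) f" by blast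
  then obtain m where "m \<in> keys f" by fastforce
  with f that show thesis
    by (auto simp: I_def monomial_span_def homogeneous_def mon_degree_def)
qed

lemma degree_monomial_power:
  assumes E: "finite E" and B: "\<And>B. B \<in> \<B> \<Longrightarrow> d \<le> card B"
    and m: "m \<in> monomial_power E (cover_monomials E \<B>) r"
  shows "r * d \<le> mon_degree m"
  using m
proof (induction r arbitrary: m)
  case (Suc r)
  then obtain a b where ab: "m = a + b" "a \<in> monomial_power E (cover_monomials E \<B>) r"
      "b \<in> cover_monomials E \<B>" by auto
  then obtain B where "B \<in> \<B>" "B \<subseteq> keys b" by (auto simp: cover_monomials_def)
  then have "d \<le> card (keys b)" using assms(2)[of B] card_mono[of "keys b" B] by simp
  also have "\<dots> = (\<Sum>e\<in>keys b. 1)" by simp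
  also have "\<dots> \<le> mon_degree b"
    unfolding mon_degree_def by (rule sum_mono) (auto simp: in_keys_iff)
  finally have "d \<le> mon_degree b" .
  moreover have "mon_degree m = mon_degree a + mon_degree b"
  proof -
    have "mon_degree a = (\<Sum>e\<in>keys m. lookup a e)" "mon_degree b = (\<Sum>e\<in>keys m. lookup b e)"
      unfolding ab(1) by (rule mon_degree_eq_sum; simp add: monomials_def keys_add_nat)+
    then show ?thesis by (simp add: ab(1) mon_degree_def lookup_add sum.distrib)
  qed
  ultimately show ?case using Suc.IH[OF ab(2)] by simp
qed simp

text \<open>If the sets of \<open>\<B>\<close>, taken with multiplicities \<open>c\<close>, fit into the exponent vector \<open>m\<close>, their
  generators can be split off from \<open>m\<close> one after the other.\<close>

lemma monomial_powerI:
  fixes c :: "'e set \<Rightarrow> nat"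
  assumes E: "finite E" and B: "finite \<B>" "\<And>B. B \<in> \<B> \<Longrightarrow> B \<subseteq> E"
    and "m \<in> monomials E" "r \<le> sum c \<B>"
    and "\<And>e. e \<in> E \<Longrightarrow> (\<Sum>B | B \<in> \<B> \<and> e \<in> B. c B) \<le> lookup m e"
  shows "m \<in> monomial_power E (cover_monomials E \<B>) r"
  using assms(4-6)
proof (induction r arbitrary: m c)
  case (Suc r)
  then have "sum c \<B> \<noteq> 0" by simp
  then obtain B0 where B0: "B0 \<in> \<B>" "c B0 \<noteq> 0" by (auto simp: B)
  have fB0: "finite B0" using B(2)[OF B0(1)] E finite_subset by blast
  define c' where "c' = c(B0 := c B0 - 1)"
  have c_eq: "c B = c' B + (if B = B0 then 1 else 0)" for B
    using B0 by (simp add: c'_def)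
  have "e \<in> keys m" if "e \<in> B0" for e
  proof -
    have "c B0 \<le> (\<Sum>B | B \<in> \<B> \<and> e \<in> B. c B)"
      using that B0 B by (intro member_le_sum) auto
    also have "\<dots> \<le> lookup m e" using Suc.prems(3) that B(2) B0 by blast
    finally show ?thesis using B0 by (simp add: in_keys_iff)
  qed
  then have sub: "B0 \<subseteq> keys m" by blast
  note eq = diff_indicator_mon[OF fB0 sub]
  have "m - indicator_mon B0 \<in> monomial_power E (cover_monomials E \<B>) r"
  proof (rule Suc.IH[of _ c'])
    show "m - indicator_mon B0 \<in> monomials E"
      using Suc.prems(1) by (fastforce simp: monomials_def in_keys_iff lookup_minus)
    have "sum c \<B> = sum c' \<B> + 1"
      using B0 B by (simp add: c_eq sum.distrib sum.delta)
    then show "r \<le> sum c' \<B>" using Suc.prems(2) by simp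
    fix e assume "e \<in> E"
    have "(\<Sum>B | B \<in> \<B> \<and> e \<in> B. c B) =
        (\<Sum>B | B \<in> \<B> \<and> e \<in> B. c' B) + (if e \<in> B0 then 1 else 0)"
      using B0 B by (simp add: c_eq sum.distrib sum.delta)
    then show "(\<Sum>B | B \<in> \<B> \<and> e \<in> B. c' B) \<le> lookup (m - indicator_mon B0) e"
      using Suc.prems(3)[OF \<open>e \<in> E\<close>] by (simp add: lookup_minus lookup_indicator_mon[OF fB0] split: if_splits)
  qed
  moreover have "indicator_mon B0 \<in> cover_monomials E \<B>"
    using B0 B fB0 by (auto simp: cover_monomials_def monomials_def keys_indicator_mon)
  ultimately show ?case
    unfolding monomial_power.simps mem_Collect_eq
    using eq by (intro exI[of _ "m - indicator_mon B0"] exI[of _ "indicator_mon B0"]) simp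
qed simp

section \<open>Linear programming duality for packings\<close>

text \<open>This is Farkas' lemma, by Bartl's induction on the number of vectors: if the
  vector \<open>c a\<close> is indispensable, there is a \<open>z\<close> that separates \<open>g\<close> from all the other vectors
  and has product 1 with \<open>c a\<close>. Subtracting multiples of \<open>c a\<close> makes all vectors orthogonal
  to \<open>z\<close>, and then \<open>c a\<close> can be dropped.\<close>

lemma farkas_columns:
  fixes c :: "'j \<Rightarrow> 'i \<Rightarrow> real" and g :: "'i \<Rightarrow> real"
  assumes fin: "finite J" "finite X"
    and impl: "\<And>x. (\<And>j. j \<in> J \<Longrightarrow> (\<Sum>i\<in>X. c j i * x i) \<le> 0) \<Longrightarrow> (\<Sum>i\<in>X. g i * x i) \<le> 0"
  shows "\<exists>l. (\<forall>j\<in>J. 0 \<le> l j) \<and> (\<forall>i\<in>X. g i = (\<Sum>j\<in>J. l j * c j i))"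
  using fin(1) impl
proof (induction J arbitrary: c g rule: finite_induct)
  case empty
  have "g i = 0" if i: "i \<in> X" for i
  proof -
    have "(\<Sum>k\<in>X. g k * (if k = i then s else 0)) = g i * s" for s
      using i fin(2) by (simp add: if_distrib[of "\<lambda>x. g _ * x"] cong: if_cong)
    then have "g i * s \<le> 0" for s
      using empty[of "\<lambda>k. if k = i then s else 0"] by simp
    from this[of "g i"] show ?thesis by (auto simp: mult_le_0_iff)
  qed
  then show ?case by simp
next
  case (insert a J)
  define dot where "dot u x = (\<Sum>i\<in>X. u i * x i)" for u x :: "'i \<Rightarrow> real"
  have dot_diff: "dot (\<lambda>i. u i - s * v i) x = dot u x - s * dot v x" for u v x s
    by (simp add: dot_def sum_subtractf sum_distrib_left algebra_simps)
  have dot_diff2: "dot u (\<lambda>i. x i - s * y i) = dot u x - s * dot u y" for u x y s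
    by (simp add: dot_def sum_subtractf sum_distrib_left algebra_simps)
  have prems: "dot g x \<le> 0" if "\<And>j. j \<in> insert a J \<Longrightarrow> dot (c j) x \<le> 0" for x
    using insert.prems[of x] that by (simp add: dot_def)
  show ?case
  proof (cases "\<forall>x. (\<forall>j\<in>J. dot (c j) x \<le> 0) \<longrightarrow> dot g x \<le> 0")
    case True
    then obtain l where l: "\<forall>j\<in>J. 0 \<le> l j" "\<forall>i\<in>X. g i = (\<Sum>j\<in>J. l j * c j i)"
      using insert.IH[of c g] by (auto simp: dot_def)
    have "(\<Sum>j\<in>insert a J. (l(a := 0)) j * c j i) = (\<Sum>j\<in>J. l j * c j i)" for i
      using insert.hyps by (simp, intro sum.cong) auto
    with l show ?thesis by (intro exI[of _ "l(a := 0)"]) auto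
  next
    case False
    then obtain y where y: "\<And>j. j \<in> J \<Longrightarrow> dot (c j) y \<le> 0" "dot g y > 0" by force
    have ya: "dot (c a) y > 0"
      using prems[of y] y by force
    define z where "z i = y i / dot (c a) y" for i
    have dz: "dot u z = dot u y / dot (c a) y" for u
      by (simp add: dot_def z_def sum_divide_distrib)
    have z: "\<And>j. j \<in> J \<Longrightarrow> dot (c j) z \<le> 0" "dot g z > 0" "dot (c a) z = 1"
      using y ya by (auto simp: dz divide_nonpos_pos)
    define c' where "c' j i = c j i - dot (c j) z * c a i" for j i
    define g' where "g' i = g i - dot g z * c a i" for i
    have "\<exists>l. (\<forall>j\<in>J. 0 \<le> l j) \<and> (\<forall>i\<in>X. g' i = (\<Sum>j\<in>J. l j * c' j i))"
    proof (rule insert.IH)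
      fix x assume x: "\<And>j. j \<in> J \<Longrightarrow> (\<Sum>i\<in>X. c' j i * x i) \<le> 0"
      define x' where "x' i = x i - dot (c a) x * z i" for i
      have swap: "dot (\<lambda>i. u i - dot u z * c a i) x = dot u x'" for u
        unfolding x'_def by (simp add: dot_diff dot_diff2)
      have "dot (c j) x' \<le> 0" if "j \<in> insert a J" for j
      proof (cases "j = a")
        case True
        then show ?thesis using z(3) unfolding x'_def by (simp add: dot_diff2)
      next
        case False
        then show ?thesis using x[of j] that swap[of "c j"] by (simp add: c'_def dot_def)
      qed
      then have "dot g x' \<le> 0" by (rule prems)
      then show "(\<Sum>i\<in>X. g' i * x i) \<le> 0"
        using swap[of g] by (simp add: g'_def dot_def)
    qed
    then obtain l where l: "\<And>j. j \<in> J \<Longrightarrow> 0 \<le> l j"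
        "\<And>i. i \<in> X \<Longrightarrow> g' i = (\<Sum>j\<in>J. l j * c' j i)" by blast
    define s where "s = dot g z - (\<Sum>j\<in>J. l j * dot (c j) z)"
    have "(\<Sum>j\<in>J. l j * dot (c j) z) \<le> 0"
      using l z by (intro sum_nonpos mult_nonneg_nonpos) auto
    then have s: "0 \<le> s" using z by (simp add: s_def)
    have "g i = (\<Sum>j\<in>insert a J. (l(a := s)) j * c j i)" if i: "i \<in> X" for i
    proof -
      have "(\<Sum>j\<in>insert a J. (l(a := s)) j * c j i) = s * c a i + (\<Sum>j\<in>J. l j * c j i)"
        using insert.hyps by (simp, intro sum.cong) auto
      also have "(\<Sum>j\<in>J. l j * c j i) =
          (\<Sum>j\<in>J. l j * c' j i) + (\<Sum>j\<in>J. l j * dot (c j) z) * c a i"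
        by (simp add: c'_def algebra_simps sum.distrib sum_subtractf sum_distrib_left)
      also have "s * c a i + \<dots> = g i"
        using l(2)[OF i] by (simp add: s_def g'_def algebra_simps)
      finally show ?thesis by simp
    qed
    with l s show ?thesis by (intro exI[of _ "l(a := s)"]) auto
  qed
qed

lemma sum_option: "finite E \<Longrightarrow> (\<Sum>i\<in>insert None (Some ` E). f i) = f None + (\<Sum>e\<in>E. f (Some e))"
  by (simp add: sum.reindex)

text \<open>This is linear programming duality for packing. A packing of total size \<open>r\<close> expresses
  the vector \<open>(r, a)\<close> as a nonnegative combination of the vectors \<open>(1, indicator of B)\<close> and of
  unit vectors, which take up the slack. A separating functional would be a nonnegative weight
  for which all sets of \<open>\<B>\<close> are too heavy.\<close>

lemma fractional_packing:
  fixes a :: "'e \<Rightarrow> real" and r :: real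
  assumes E: "finite E" and B: "finite \<B>" "\<And>B. B \<in> \<B> \<Longrightarrow> B \<subseteq> E"
    and weight: "\<And>w. (\<And>e. e \<in> E \<Longrightarrow> 0 \<le> w e) \<Longrightarrow>
      \<exists>B\<in>\<B>. r * (\<Sum>e\<in>B. w e) \<le> (\<Sum>e\<in>E. a e * w e)"
    and r: "0 \<le> r"
  shows "\<exists>l. (\<forall>B\<in>\<B>. 0 \<le> l B) \<and> (\<Sum>B\<in>\<B>. l B) = r \<and>
    (\<forall>e\<in>E. (\<Sum>B | B \<in> \<B> \<and> e \<in> B. l B) \<le> a e)"
proof -
  define c where "c j i = (case j of
      Inl B \<Rightarrow> (case i of None \<Rightarrow> 1 | Some e \<Rightarrow> if e \<in> B then 1 else (0::real))
    | Inr e' \<Rightarrow> (case i of None \<Rightarrow> 0 | Some e \<Rightarrow> if e = e' then 1 else 0))"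
    for j :: "'e set + 'e" and i :: "'e option"
  define g where "g i = (case i of None \<Rightarrow> r | Some e \<Rightarrow> a e)" for i
  let ?X = "insert None (Some ` E)" and ?J = "\<B> <+> E"
  have "\<exists>l. (\<forall>j\<in>?J. 0 \<le> l j) \<and> (\<forall>i\<in>?X. g i = (\<Sum>j\<in>?J. l j * c j i))"
  proof (rule farkas_columns)
    fix x assume x: "\<And>j. j \<in> ?J \<Longrightarrow> (\<Sum>i\<in>?X. c j i * x i) \<le> 0"
    define w where "w e = - x (Some e)" for e
    have "0 \<le> w e" if "e \<in> E" for e
    proof -
      have "(\<Sum>i\<in>?X. c (Inr e) i * x i) = (\<Sum>e'\<in>E. if e' = e then x (Some e') else 0)"
        unfolding sum_option[OF E] by (auto simp: c_def intro: sum.cong)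
      then show ?thesis using x[OF InrI[OF that]] that E by (simp add: w_def)
    qed
    then obtain B where Bw: "B \<in> \<B>" "r * (\<Sum>e\<in>B. w e) \<le> (\<Sum>e\<in>E. a e * w e)"
      using weight by blast
    have "(\<Sum>e\<in>E. (if e \<in> B then 1 else 0) * x (Some e)) = (\<Sum>e\<in>B. x (Some e))"
      using B(2)[OF Bw(1)] E
      by (simp add: if_distrib[of "\<lambda>u. u * _"] sum.If_cases Int_absorb1 cong: if_cong)
    then have "x None \<le> (\<Sum>e\<in>B. w e)"
      using x[OF InlI[OF Bw(1)]] unfolding sum_option[OF E] by (simp add: c_def w_def sum_negf)
    then have "r * x None \<le> (\<Sum>e\<in>E. a e * w e)"
      using r Bw(2) mult_left_mono by fastforce
    then show "(\<Sum>i\<in>?X. g i * x i) \<le> 0"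
      unfolding sum_option[OF E] by (simp add: g_def w_def sum_negf)
  qed (use E B in auto)
  then obtain l where l0: "\<forall>j\<in>?J. 0 \<le> l j" "\<forall>i\<in>?X. g i = (\<Sum>j\<in>?J. l j * c j i)" by blast
  have l: "\<And>j. j \<in> ?J \<Longrightarrow> 0 \<le> l j"
    "\<And>i. i \<in> ?X \<Longrightarrow> g i = (\<Sum>B\<in>\<B>. l (Inl B) * c (Inl B) i) + (\<Sum>e\<in>E. l (Inr e) * c (Inr e) i)"
    using l0 by (auto simp add: sum.Plus[OF B(1) E])
  have "(\<Sum>B\<in>\<B>. l (Inl B)) = r"
    using l(2)[of None] by (simp add: g_def c_def)
  moreover have "(\<Sum>B | B \<in> \<B> \<and> e \<in> B. l (Inl B)) \<le> a e" if e: "e \<in> E" for e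
  proof -
    have "a e = (\<Sum>B\<in>\<B>. l (Inl B) * (if e \<in> B then 1 else 0)) +
        (\<Sum>e'\<in>E. l (Inr e') * (if e = e' then 1 else 0))"
      using l(2)[of "Some e"] e by (simp add: g_def c_def)
    also have "(\<Sum>B\<in>\<B>. l (Inl B) * (if e \<in> B then 1 else 0)) = (\<Sum>B | B \<in> \<B> \<and> e \<in> B. l (Inl B))"
      using B by (simp add: if_distrib[of "\<lambda>u. _ * u"] sum.inter_filter cong: if_cong)
    also have "(\<Sum>e'\<in>E. l (Inr e') * (if e = e' then 1 else 0)) = l (Inr e)"
      using E e by (simp add: if_distrib[of "\<lambda>u. _ * u"] cong: if_cong)
    finally show ?thesis using l(1)[OF InrI[OF e]] by simp
  qed
  ultimately show ?thesis using l(1) by (intro exI[of _ "\<lambda>B. l (Inl B)"]) auto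
qed

text \<open>Rounding all multiplicities down loses less than 1 per set, that is, at most the constant
  \<open>card \<B>\<close>, whatever \<open>a\<close> is.\<close>

lemma fractional_packing_floor:
  fixes a :: "'e \<Rightarrow> nat" and r :: real
  assumes E: "finite E" and B: "finite \<B>" "\<And>B. B \<in> \<B> \<Longrightarrow> B \<subseteq> E"
    and weight: "\<And>w. (\<And>e. e \<in> E \<Longrightarrow> 0 \<le> w e) \<Longrightarrow>
      \<exists>B\<in>\<B>. r * (\<Sum>e\<in>B. w e) \<le> (\<Sum>e\<in>E. real (a e) * w e)"
    and r: "0 \<le> r"
  shows "\<exists>c :: 'e set \<Rightarrow> nat. r - real (card \<B>) \<le> real (sum c \<B>) \<and>
    (\<forall>e\<in>E. (\<Sum>B | B \<in> \<B> \<and> e \<in> B. c B) \<le> a e)"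
proof -
  obtain l where l: "\<forall>B\<in>\<B>. 0 \<le> l B" "(\<Sum>B\<in>\<B>. l B) = r"
      "\<forall>e\<in>E. (\<Sum>B | B \<in> \<B> \<and> e \<in> B. l B) \<le> real (a e)"
    using fractional_packing[OF E B weight r] by blast
  define c where "c B = nat \<lfloor>l B\<rfloor>" for B
  have c: "l B - 1 \<le> real (c B)" "real (c B) \<le> l B" if "B \<in> \<B>" for B
    using l(1) that unfolding c_def by (auto simp: of_nat_nat)
  have "r - real (card \<B>) = (\<Sum>B\<in>\<B>. l B - 1)"
    using l(2) by (simp add: sum_subtractf)
  also have "\<dots> \<le> real (sum c \<B>)"
    using c by (simp add: sum_mono)
  finally have "r - real (card \<B>) \<le> real (sum c \<B>)" .
  moreover have "(\<Sum>B | B \<in> \<B> \<and> e \<in> B. c B) \<le> a e" if "e \<in> E" for e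
  proof -
    have "real (\<Sum>B | B \<in> \<B> \<and> e \<in> B. c B) \<le> (\<Sum>B | B \<in> \<B> \<and> e \<in> B. l B)"
      using c by (auto intro!: sum_mono)
    also have "\<dots> \<le> real (a e)" using l(3) that by blast
    finally show ?thesis by linarith
  qed
  ultimately show ?thesis by blast
qed

text \<open>A nonnegative function is a nonnegative combination of indicators of its superlevel sets; the
  induction peels off the outermost of them, at the least positive value of \<open>w\<close>.\<close>

lemma level_set_sum_nonneg:
  fixes w b :: "'e \<Rightarrow> real"
  assumes E: "finite E" and w: "\<And>e. e \<in> E \<Longrightarrow> 0 \<le> w e"
    and level: "\<And>t. 0 < t \<Longrightarrow> 0 \<le> (\<Sum>e | e \<in> E \<and> t \<le> w e. b e)"
  shows "0 \<le> (\<Sum>e\<in>E. b e * w e)"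
  using w level
proof (induction "card {e \<in> E. 0 < w e}" arbitrary: w rule: less_induct)
  case less
  let ?S = "{e \<in> E. 0 < w e}"
  have fS: "finite ?S" using E by simp
  show ?case
  proof (cases "?S = {}")
    case True
    then have "\<And>e. e \<in> E \<Longrightarrow> w e = 0" using less.prems(1) by force
    then show ?thesis by simp
  next
    case False
    \<comment> \<open>subtracting \<open>t\<close> on \<open>?S\<close> shrinks the support of \<open>w\<close>\<close>
    define t where "t = Min (w ` ?S)"
    have t: "t \<in> w ` ?S" "\<And>e. e \<in> ?S \<Longrightarrow> t \<le> w e"
      using fS False by (auto simp: t_def intro: Min_in)
    then have t0: "0 < t" by auto
    define w' where "w' e = (if 0 < w e then w e - t else 0)" for e
    have S_eq: "?S = {e \<in> E. t \<le> w e}" using t t0 by force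
    obtain e0 where e0: "e0 \<in> ?S" "w e0 = t" using t(1) by auto
    have "{e \<in> E. 0 < w' e} \<subset> ?S"
    proof
      show "{e \<in> E. 0 < w' e} \<subseteq> ?S" by (auto simp: w'_def split: if_splits)
      show "{e \<in> E. 0 < w' e} \<noteq> ?S" using e0 by (auto simp: w'_def)
    qed
    then have "card {e \<in> E. 0 < w' e} < card ?S" by (rule psubset_card_mono[OF fS])
    moreover have "0 \<le> w' e" if "e \<in> E" for e
      using that t(2)[of e] by (auto simp: w'_def)
    moreover have "0 \<le> (\<Sum>e | e \<in> E \<and> s \<le> w' e. b e)" if s: "0 < s" for s
    proof -
      have "{e \<in> E. s \<le> w' e} = {e \<in> E. s + t \<le> w e}"
        using s t0 by (auto simp: w'_def split: if_splits)
      then show ?thesis using less.prems(2)[of "s + t"] s t0 by simp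
    qed
    ultimately have "0 \<le> (\<Sum>e\<in>E. b e * w' e)"
      by (rule less.hyps)
    moreover have "(\<Sum>e\<in>E. b e * w e) = (\<Sum>e\<in>E. b e * w' e) + t * (\<Sum>e\<in>?S. b e)"
    proof -
      have "b e * w e = b e * w' e + (if 0 < w e then t * b e else 0)" if "e \<in> E" for e
        using less.prems(1)[OF that] by (auto simp: w'_def algebra_simps)
      then show ?thesis
        using E by (simp add: sum.distrib sum_distrib_left flip: sum.inter_filter)
    qed
    moreover have "0 \<le> t * (\<Sum>e\<in>?S. b e)"
      unfolding S_eq using less.prems(2)[OF t0] t0 by simp
    ultimately show ?thesis by simp
  qed
qed

section \<open>Components, forests and cycles\<close>

abbreviation arcs :: "'v set set \<Rightarrow> ('v \<times> 'v) set" where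
  "arcs F \<equiv> {(x, y). {x, y} \<in> F}"

lemma arcs_rtrancl_sym: "(x, y) \<in> (arcs F)\<^sup>* \<Longrightarrow> (y, x) \<in> (arcs F)\<^sup>*"
proof -
  have "sym (arcs F)" by (auto simp: sym_def insert_commute)
  then have "sym ((arcs F)\<^sup>*)" by (rule sym_rtrancl)
  then show "(x, y) \<in> (arcs F)\<^sup>* \<Longrightarrow> (y, x) \<in> (arcs F)\<^sup>*" by (rule symD)
qed

lemma equiv_connected_rel: "equiv V (connected_rel V F)"
proof (rule equivI)
  show "refl_on V (connected_rel V F)" by (auto simp: refl_on_def connected_rel_def)
  show "sym (connected_rel V F)" by (auto simp: sym_def connected_rel_def arcs_rtrancl_sym)
  show "trans (connected_rel V F)" by (auto simp: trans_def connected_rel_def)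
qed (auto simp: connected_rel_def)

lemma arcs_insert: "arcs (insert {u, v} F) = insert (u, v) (insert (v, u) (arcs F))"
proof -
  have "{x, y} \<in> insert {u, v} F \<longleftrightarrow> (x = u \<and> y = v) \<or> (x = v \<and> y = u) \<or> {x, y} \<in> F" for x y
    by (simp add: doubleton_eq_iff disj_assoc)
  then show ?thesis by auto
qed

lemma connected_rel_insert:
  assumes "u \<in> V" "v \<in> V"
  shows "(x, y) \<in> connected_rel V (insert {u, v} F) \<longleftrightarrow>
    (x, y) \<in> connected_rel V F \<or>
    (x, u) \<in> connected_rel V F \<and> (v, y) \<in> connected_rel V F \<or>
    (x, v) \<in> connected_rel V F \<and> (u, y) \<in> connected_rel V F"
proof -
  have "(x, y) \<in> (arcs (insert {u, v} F))\<^sup>* \<longleftrightarrow>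
    (x, y) \<in> (arcs F)\<^sup>* \<or> (x, u) \<in> (arcs F)\<^sup>* \<and> (v, y) \<in> (arcs F)\<^sup>* \<or>
    (x, v) \<in> (arcs F)\<^sup>* \<and> (u, y) \<in> (arcs F)\<^sup>*"
    unfolding arcs_insert rtrancl_insert
    by simp (meson arcs_rtrancl_sym rtrancl_trans)
  then show ?thesis using assms by (auto simp: connected_rel_def)
qed

lemma connected_rel_insert_redundant:
  assumes uv: "(u, v) \<in> connected_rel V F"
  shows "connected_rel V (insert {u, v} F) = connected_rel V F"
proof -
  have V: "u \<in> V" "v \<in> V" using uv by (auto simp: connected_rel_def)
  have "(x, y) \<in> connected_rel V F"
    if "(x, u) \<in> connected_rel V F \<and> (v, y) \<in> connected_rel V F \<or>
      (x, v) \<in> connected_rel V F \<and> (u, y) \<in> connected_rel V F" for x y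
    using that uv equiv_connected_rel[of V F] by (meson equiv_def symD transD)
  then have "(x, y) \<in> connected_rel V (insert {u, v} F) \<longleftrightarrow> (x, y) \<in> connected_rel V F" for x y
    using connected_rel_insert[OF V, of x y F] by blast
  then show ?thesis by (simp add: set_eq_iff)
qed

text \<open>The classes of the two ends of the new edge merge, and the other classes stay.\<close>

lemma num_components_insert:
  assumes V: "finite V" "u \<in> V" "v \<in> V" and uv: "(u, v) \<notin> connected_rel V F"
  shows "num_components V F = Suc (num_components V (insert {u, v} F))"
proof -
  let ?r = "connected_rel V F" and ?r' = "connected_rel V (insert {u, v} F)"
  let ?U = "?r `` {u}" and ?W = "?r `` {v}"
  note eq = equiv_connected_rel[of V F]
  have sym: "(x, y) \<in> ?r \<longleftrightarrow> (y, x) \<in> ?r" for x y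
    using eq by (meson equiv_def symD)
  have trans: "(x, y) \<in> ?r \<Longrightarrow> (y, z) \<in> ?r \<Longrightarrow> (x, z) \<in> ?r" for x y z
    using eq by (meson equiv_def transD)
  have cls: "?r' `` {x} = (if x \<in> ?U \<union> ?W then ?U \<union> ?W else ?r `` {x})" for x
  proof (rule Set.set_eqI)
    fix y
    show "y \<in> ?r' `` {x} \<longleftrightarrow> y \<in> (if x \<in> ?U \<union> ?W then ?U \<union> ?W else ?r `` {x})"
      using sym trans by (simp add: connected_rel_insert[OF V(2,3)]) blast
  qed
  have self: "u \<in> ?U" "v \<in> ?W" using eq V by (auto dest: equiv_class_self)
  have UW: "?U \<in> V // ?r" "?W \<in> V // ?r" "?U \<noteq> ?W"
    using V eq uv by (auto intro: quotientI simp: eq_equiv_class_iff)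
  have q: "V // ?r' = insert (?U \<union> ?W) (V // ?r - {?U, ?W})"
  proof (intro equalityI subsetI)
    fix X assume "X \<in> V // ?r'"
    then obtain x where x: "x \<in> V" "X = ?r' `` {x}" by (auto elim: quotientE)
    show "X \<in> insert (?U \<union> ?W) (V // ?r - {?U, ?W})"
    proof (cases "x \<in> ?U \<union> ?W")
      case True
      then show ?thesis using x cls[of x] by simp
    next
      case False
      then have "x \<in> ?r `` {x}" "?r `` {x} \<noteq> ?U" "?r `` {x} \<noteq> ?W"
        using equiv_class_self[OF eq x(1)] by auto
      then show ?thesis using x cls[of x] False by (auto intro: quotientI)
    qed
  next
    fix X assume X: "X \<in> insert (?U \<union> ?W) (V // ?r - {?U, ?W})"
    show "X \<in> V // ?r'"
    proof (cases "X = ?U \<union> ?W")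
      case True
      then have "X = ?r' `` {u}" using self cls[of u] by simp
      then show ?thesis using V by (auto intro: quotientI)
    next
      case False
      with X have XQ: "X \<in> V // ?r" "X \<noteq> ?U" "X \<noteq> ?W" by blast+
      from XQ(1) obtain x where x: "x \<in> V" "X = ?r `` {x}" by (rule quotientE)
      with XQ(2,3) have "x \<notin> ?U \<union> ?W"
        using equiv_class_eq[OF eq, of u x] equiv_class_eq[OF eq, of v x] by auto
      then have "X = ?r' `` {x}" using cls[of x] x by simp
      then show ?thesis using x by (auto intro: quotientI)
    qed
  qed
  have fin: "finite (V // ?r)" using V(1) by (simp add: quotient_def)
  have "?U \<union> ?W \<notin> V // ?r - {?U, ?W}"
  proof
    assume A: "?U \<union> ?W \<in> V // ?r - {?U, ?W}"
    then have "?U \<union> ?W = ?U \<or> (?U \<union> ?W) \<inter> ?U = {}"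
      using quotient_disj[OF eq] UW(1) by blast
    with A self show False by auto
  qed
  then have "card (V // ?r') = Suc (card (V // ?r - {?U, ?W}))"
    unfolding q using fin by simp
  moreover have "card (V // ?r - {?U, ?W}) = card (V // ?r) - 2"
    using UW by (subst card_Diff_subset) auto
  moreover have "card (V // ?r) \<ge> 2"
    using card_mono[OF fin, of "{?U, ?W}"] UW by simp
  ultimately show ?thesis by (simp add: num_components_def)
qed

lemma num_components_empty: "num_components V {} = card V"
proof -
  have "connected_rel V {} = Id_on V" by (auto simp: connected_rel_def)
  then have "V // connected_rel V {} = (\<lambda>x. {x}) ` V" by (auto simp: quotient_def)
  then show ?thesis by (simp add: num_components_def card_image)
qed

lemma simple_graph_subset: "simple_graph V E \<Longrightarrow> F \<subseteq> E \<Longrightarrow> simple_graph V F"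
  by (auto simp: simple_graph_def)

lemma simple_graph_finite: "simple_graph V E \<Longrightarrow> finite E"
proof -
  assume "simple_graph V E"
  then have "E \<subseteq> Pow V" "finite (Pow V)" by (auto simp: simple_graph_def)
  then show ?thesis by (rule finite_subset)
qed

lemma simple_graph_edgeE:
  assumes "simple_graph V E" "e \<in> E"
  obtains u v where "e = {u, v}" "u \<in> V" "v \<in> V" "u \<noteq> v"
proof -
  have "card e = 2" "e \<subseteq> V" using assms by (auto simp: simple_graph_def)
  with that show thesis by (auto simp: card_2_iff)
qed

text \<open>Each edge lowers the number of components by at most one.\<close>

lemma card_le_num_components:
  assumes "simple_graph V F"
  shows "card V \<le> num_components V F + card F"
  using simple_graph_finite[OF assms] assms
proof (induction F rule: finite_induct)
  case empty
  then show ?case by (simp add: num_components_empty)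
next
  case (insert e F)
  have V: "finite V" using insert.prems by (simp add: simple_graph_def)
  have F: "simple_graph V F" using insert.prems by (rule simple_graph_subset) auto
  obtain u v where e: "e = {u, v}" "u \<in> V" "v \<in> V"
    using simple_graph_edgeE[OF insert.prems, of e] by blast
  show ?case
  proof (cases "(u, v) \<in> connected_rel V F")
    case True
    then have "num_components V (insert e F) = num_components V F"
      unfolding e(1) by (simp add: num_components_def connected_rel_insert_redundant)
    then show ?thesis using insert.IH[OF F] insert.hyps by simp
  next
    case False
    then show ?thesis
      using insert.IH[OF F] insert.hyps num_components_insert[OF V e(2,3)] e(1) by simp
  qed
qed

text \<open>Equality in \<open>card_le_num_components\<close>. This form of acyclicity is the one that supports
  counting and the insertion of edges.\<close>

definition forest :: "'v set \<Rightarrow> 'v set set \<Rightarrow> bool" where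
  "forest V F \<longleftrightarrow> num_components V F + card F = card V"

lemma is_cycle_mono:
  assumes c: "is_cycle G c" and sub: "G \<subseteq> F"
  shows "is_cycle F c"
  unfolding is_cycle_def
proof (intro conjI allI impI)
  fix i assume "i < length c"
  then have "{c ! i, c ! (Suc i mod length c)} \<in> G" using c by (simp add: is_cycle_def)
  then show "{c ! i, c ! (Suc i mod length c)} \<in> F" using sub by (rule rev_subsetD)
qed (use c in \<open>simp_all add: is_cycle_def\<close>)

lemma acyclic_edges_subset: "acyclic_edges F \<Longrightarrow> G \<subseteq> F \<Longrightarrow> acyclic_edges G"
  unfolding acyclic_edges_def by (erule contrapos_nn, erule exE, rule exI, erule (1) is_cycle_mono)

text \<open>The ends of an edge of a cycle are joined by the rest of the cycle.\<close>

lemma cycle_edge_redundant: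
  assumes c: "is_cycle F c" and V: "\<Union>F \<subseteq> V"
  shows "\<exists>u v. {u, v} \<in> F \<and> (u, v) \<in> connected_rel V (F - {{u, v}})"
proof -
  define n where "n = length c"
  have n: "n \<ge> 3" and d: "distinct c"
    and edge: "\<And>i. i < n \<Longrightarrow> {c ! i, c ! (Suc i mod n)} \<in> F"
    using c by (auto simp: is_cycle_def n_def)
  let ?u = "c ! 0" and ?v = "c ! (n - 1)"
  have e: "{?u, ?v} \<in> F"
    using edge[of "n - 1"] n by (simp add: insert_commute)
  have "(?u, c ! i) \<in> (arcs (F - {{?u, ?v}}))\<^sup>*" if "i < n" for i
    using that
  proof (induction i)
    case (Suc i)
    have "{c ! i, c ! Suc i} \<in> F" using edge[of i] Suc.prems by simp
    moreover have "{c ! i, c ! Suc i} \<noteq> {?u, ?v}"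
    proof
      assume "{c ! i, c ! Suc i} = {?u, ?v}"
      then have "c ! i = ?u \<and> c ! Suc i = ?v \<or> c ! i = ?v \<and> c ! Suc i = ?u"
        by (auto simp: doubleton_eq_iff)
      moreover have "c ! i = ?u \<longleftrightarrow> i = 0" "c ! i = ?v \<longleftrightarrow> i = n - 1"
          "c ! Suc i = ?u \<longleftrightarrow> Suc i = 0" "c ! Suc i = ?v \<longleftrightarrow> Suc i = n - 1"
        using Suc.prems n unfolding n_def by (intro nth_eq_iff_index_eq[OF d]; linarith)+
      ultimately have "i = 0 \<and> Suc i = n - 1 \<or> i = n - 1 \<and> Suc i = 0" by blast
      then show False using n Suc.prems by linarith
    qed
    ultimately show ?case using Suc.IH Suc.prems by (auto intro: rtrancl_into_rtrancl)
  qed simp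
  then have "(?u, ?v) \<in> connected_rel V (F - {{?u, ?v}})"
    using n e V by (auto simp: connected_rel_def)
  with e show ?thesis by blast
qed

text \<open>A path without repeated vertices between the ends of an edge, avoiding this edge, is closed to
  a cycle by it. The path has at least two edges, as otherwise it would be the edge itself.\<close>

lemma redundant_edge_cycle:
  assumes e: "{u, v} \<in> F" "u \<noteq> v" and uv: "(u, v) \<in> connected_rel V (F - {{u, v}})"
  shows "\<exists>c. is_cycle F c"
proof -
  let ?r = "\<lambda>x y. {x, y} \<in> F - {{u, v}}"
  have "?r\<^sup>*\<^sup>* u v"
    using uv by (simp add: connected_rel_def rtranclp_rtrancl_eq)
  then obtain xs0 where "rtrancl_path ?r u xs0 v"
    by (auto simp: rtranclp_eq_rtrancl_path)
  then obtain xs where p: "rtrancl_path ?r u xs v" and d: "distinct (u # xs)"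
    by (rule rtrancl_path_distinct)
  have step: "?r ((u # xs) ! i) (xs ! i)" if "i < length xs" for i
    using rtrancl_path_nth[OF p that] .
  have ne: "xs \<noteq> []" using p e(2) by (auto elim: rtrancl_path.cases)
  have last: "last xs = v" using rtrancl_path_last[OF p ne] .
  have "length xs \<noteq> 1"
  proof
    assume "length xs = 1"
    then obtain y where "xs = [y]" by (auto simp: length_Suc_conv)
    then show False using step[of 0] last by simp
  qed
  with ne have len: "length xs \<ge> 2" by (cases xs) (auto simp: Suc_le_eq)
  let ?c = "u # xs"
  have "is_cycle F ?c"
    unfolding is_cycle_def
  proof (intro conjI allI impI)
    fix i assume i: "i < length ?c"
    show "{?c ! i, ?c ! (Suc i mod length ?c)} \<in> F"
    proof (cases "i = length xs")
      case True
      then have "?c ! i = v" using last ne by (simp add: last_conv_nth nth_Cons')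
      then show ?thesis using True e(1) by (simp add: insert_commute)
    next
      case False
      then show ?thesis using step[of i] i by simp
    qed
  qed (use len d in auto)
  then show ?thesis by blast
qed

text \<open>Deleting an edge of a cycle does not change the number of components, so a graph with a cycle
  violates the equality. Conversely, building up an acyclic graph edge by edge, each new edge
  joins two components, because otherwise it would close a cycle.\<close>

lemma acyclic_iff_forest:
  assumes F: "simple_graph V F"
  shows "acyclic_edges F \<longleftrightarrow> forest V F"
proof
  have V: "\<Union>F \<subseteq> V" "finite V" using F by (auto simp: simple_graph_def)
  assume f: "forest V F"
  show "acyclic_edges F"
    unfolding acyclic_edges_def
  proof
    assume "\<exists>c. is_cycle F c"
    then obtain u v where uv: "{u, v} \<in> F" "(u, v) \<in> connected_rel V (F - {{u, v}})"
      using cycle_edge_redundant[OF _ V(1)] by blast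
    have "num_components V F = num_components V (F - {{u, v}})"
      using connected_rel_insert_redundant[OF uv(2)] uv(1)
      by (simp add: num_components_def insert_absorb)
    moreover have "card V \<le> num_components V (F - {{u, v}}) + card (F - {{u, v}})"
      by (rule card_le_num_components) (rule simple_graph_subset[OF F], auto)
    moreover have "card F = Suc (card (F - {{u, v}}))"
      using card_Suc_Diff1[OF simple_graph_finite[OF F] uv(1)] by simp
    ultimately show False using f by (simp add: forest_def)
  qed
next
  assume "acyclic_edges F"
  with simple_graph_finite[OF F] F show "forest V F"
  proof (induction F rule: finite_induct)
    case empty
    then show ?case by (simp add: forest_def num_components_empty)
  next
    case (insert e F)
    have V: "finite V" using insert.prems by (simp add: simple_graph_def)
    have F: "simple_graph V F" using insert.prems(1) by (rule simple_graph_subset) auto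
    have ac: "acyclic_edges F"
      using insert.prems(2) by (rule acyclic_edges_subset) auto
    obtain u v where e: "e = {u, v}" "u \<in> V" "v \<in> V" "u \<noteq> v"
      using simple_graph_edgeE[OF insert.prems(1), of e] by blast
    have "(u, v) \<notin> connected_rel V F"
    proof
      assume "(u, v) \<in> connected_rel V F"
      moreover have "insert e F - {e} = F" using insert.hyps by auto
      ultimately have "\<exists>c. is_cycle (insert e F) c"
        using e by (intro redundant_edge_cycle[of u v _ V]) auto
      then show False using insert.prems(2) by (simp add: acyclic_edges_def)
    qed
    then show ?case
      using insert.IH[OF F ac] insert.hyps num_components_insert[OF V e(2,3)] e(1)
      by (simp add: forest_def)
  qed
qed

lemma forest_subset:
  assumes "simple_graph V F" "forest V F" "G \<subseteq> F"
  shows "forest V G"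
proof -
  have "acyclic_edges G"
    using assms(2) acyclic_iff_forest[OF assms(1)] by (intro acyclic_edges_subset[OF _ assms(3)]) simp
  then show ?thesis using acyclic_iff_forest[OF simple_graph_subset[OF assms(1,3)]] by simp
qed

text \<open>Kruskal's algorithm, as an induction that inserts the edges in order of increasing weight: an
  edge is kept when it joins two components. The result spans the components of every sublevel
  set of the weight simultaneously.\<close>

lemma kruskal_forest:
  fixes w :: "'v set \<Rightarrow> real"
  assumes E: "simple_graph V E"
  shows "\<exists>T\<subseteq>E. forest V T \<and> connected_rel V T = connected_rel V E \<and>
    (\<forall>t. connected_rel V {e \<in> T. w e < t} = connected_rel V {e \<in> E. w e < t})"
  using simple_graph_finite[OF E] E
proof (induction E rule: finite_ranking_induct[where f = w])
  case empty
  then show ?case by (simp add: forest_def num_components_empty)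
next
  case (insert e E)
  show ?case
  proof (cases "e \<in> E")
    case True
    then show ?thesis using insert by (simp add: insert_absorb)
  next
    case False
    have V: "finite V" using insert.prems by (simp add: simple_graph_def)
    have "simple_graph V E" using insert.prems by (rule simple_graph_subset) auto
    with insert.IH obtain T where T: "T \<subseteq> E" "forest V T" "connected_rel V T = connected_rel V E"
      "\<And>t. connected_rel V {e \<in> T. w e < t} = connected_rel V {e \<in> E. w e < t}" by blast
    obtain u v where e: "e = {u, v}" "u \<in> V" "v \<in> V"
      using simple_graph_edgeE[OF insert.prems, of e] by blast
    define T' where "T' = (if (u, v) \<in> connected_rel V E then T else insert e T)"
    have conn: "connected_rel V T' = connected_rel V (insert e E)"
    proof (cases "(u, v) \<in> connected_rel V E")
      case True
      then show ?thesis
        using connected_rel_insert_redundant[of u v V E] T(3) e(1) by (simp add: T'_def)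
    next
      case False
      have "(x, y) \<in> connected_rel V (insert e T) \<longleftrightarrow> (x, y) \<in> connected_rel V (insert e E)" for x y
        unfolding e(1) connected_rel_insert[OF e(2,3)] T(3) ..
      then show ?thesis using False by (auto simp: T'_def)
    qed
    have "forest V T'"
    proof (cases "(u, v) \<in> connected_rel V E")
      case False
      have "finite T" "e \<notin> T" using T(1) insert.hyps \<open>e \<notin> E\<close> finite_subset by auto
      then show ?thesis
        using num_components_insert[OF V e(2,3), of T] False T(2,3) e(1)
        by (simp add: T'_def forest_def)
    qed (simp add: T'_def T(2))
    moreover have "connected_rel V {f \<in> T'. w f < t} = connected_rel V {f \<in> insert e E. w f < t}" for t
    proof (cases "w e < t")
      case True
      then have all: "\<And>f. f \<in> insert e E \<Longrightarrow> w f < t" using insert.hyps by fastforce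
      then have "{f \<in> insert e E. w f < t} = insert e E" by auto
      moreover have "{f \<in> T'. w f < t} = T'" using T(1) all by (auto simp: T'_def)
      ultimately show ?thesis using conn by simp
    next
      case False
      then have "{f \<in> insert e E. w f < t} = {f \<in> E. w f < t}" "{f \<in> T'. w f < t} = {f \<in> T. w f < t}"
        by (auto simp: T'_def)
      then show ?thesis using T(4)[of t] by simp
    qed
    moreover have "T' \<subseteq> insert e E" using T(1) by (auto simp: T'_def)
    ultimately show ?thesis using conn by blast
  qed
qed

section \<open>Spanning trees and cuts\<close>

definition spanning_tree :: "'v set \<Rightarrow> 'v set set \<Rightarrow> 'v set set \<Rightarrow> bool" where
  "spanning_tree V E T \<longleftrightarrow> T \<subseteq> E \<and> forest V T \<and> num_components V T = 1"

lemma num_components_eq_1_iff: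
  assumes "V \<noteq> {}"
  shows "num_components V F = 1 \<longleftrightarrow> (\<forall>u\<in>V. \<forall>v\<in>V. (u, v) \<in> connected_rel V F)"
proof
  let ?r = "connected_rel V F"
  note eq = equiv_connected_rel[of V F]
  assume "num_components V F = 1"
  then obtain X where X: "V // ?r = {X}" by (auto simp: num_components_def card_1_singleton_iff)
  have "?r `` {u} = X" if "u \<in> V" for u
    using quotientI[OF that, of ?r] X by blast
  then show "\<forall>u\<in>V. \<forall>v\<in>V. (u, v) \<in> ?r"
    using eq_equiv_class_iff[OF eq] by blast
next
  let ?r = "connected_rel V F"
  assume conn: "\<forall>u\<in>V. \<forall>v\<in>V. (u, v) \<in> ?r"
  have "?r `` {u} = V" if "u \<in> V" for u
    using conn that by (auto simp: connected_rel_def)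
  then have "V // ?r = {V}" using assms by (auto simp: quotient_def)
  then show "num_components V F = 1" by (simp add: num_components_def)
qed

lemma connected_reachable:
  assumes "num_components V F = 1" "u \<in> V" "v \<in> V"
  shows "(u, v) \<in> (arcs F)\<^sup>*"
proof -
  have "V \<noteq> {}" using assms by blast
  then have "(u, v) \<in> connected_rel V F" using num_components_eq_1_iff[of V F] assms by simp
  then show ?thesis by (simp add: connected_rel_def)
qed

lemma num_components_pos: "finite V \<Longrightarrow> V \<noteq> {} \<Longrightarrow> 0 < num_components V F"
  by (auto simp: num_components_def card_gt_0_iff quotient_def)

lemma num_components_cong:
  "connected_rel V F = connected_rel V G \<Longrightarrow> num_components V F = num_components V G"
  by (simp add: num_components_def)

lemma exists_spanning_tree:
  assumes "simple_graph V F" "num_components V F = 1"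
  shows "\<exists>T. spanning_tree V F T"
proof -
  obtain T where T: "T \<subseteq> F" "forest V T" "connected_rel V T = connected_rel V F"
    using kruskal_forest[OF assms(1), of "\<lambda>_. 0"] by blast
  then have "spanning_tree V F T"
    using num_components_cong[OF T(3)] assms(2) by (simp add: spanning_tree_def)
  then show ?thesis ..
qed

text \<open>A forest that is not connected misses an edge of the connected graph between two of its
  components, and adding this edge leaves it a forest. So maximal forests are connected, and
  connected forests are maximal because they have \<open>card V - 1\<close> edges.\<close>

lemma basis_graphic_iff:
  assumes E: "simple_graph V E" and V: "V \<noteq> {}" and conn: "num_components V E = 1"
  shows "basis (graphic_matroid E) B \<longleftrightarrow> spanning_tree V E B"
proof -
  have indep: "indep (graphic_matroid E) X \<longleftrightarrow> X \<subseteq> E \<and> forest V X" for X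
    using acyclic_iff_forest[OF simple_graph_subset[OF E]]
    by (auto simp: indep_def ground_def graphic_matroid_def)
  have finV: "finite V" using E by (simp add: simple_graph_def)
  show ?thesis
  proof
    assume B: "spanning_tree V E B"
    show "basis (graphic_matroid E) B"
      unfolding basis_def indep
    proof (intro conjI allI impI)
      show "B \<subseteq> E" "forest V B" using B by (simp_all add: spanning_tree_def)
      fix X assume X: "(X \<subseteq> E \<and> forest V X) \<and> B \<subseteq> X"
      have "finite X" using X simple_graph_finite[OF E] finite_subset by blast
      moreover have "card X \<le> card B"
        using X B num_components_pos[OF finV V, of X] by (simp add: forest_def spanning_tree_def)
      ultimately show "X = B" using X card_seteq[of X B] by simp
    qed
  next
    assume B: "basis (graphic_matroid E) B"
    have BE: "B \<subseteq> E" "forest V B" using B by (simp_all add: basis_def indep)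
    have "num_components V B = 1"
    proof (rule ccontr)
      assume "num_components V B \<noteq> 1"
      \<comment> \<open>otherwise every path of the graph would stay inside a component of \<open>B\<close>\<close>
      have "\<exists>e\<in>E. \<exists>u v. e = {u, v} \<and> u \<in> V \<and> v \<in> V \<and> (u, v) \<notin> connected_rel V B"
      proof (rule ccontr)
        assume no: "\<not> ?thesis"
        have edge: "(x, y) \<in> connected_rel V B" if "{x, y} \<in> E" for x y
        proof -
          have "x \<in> V" "y \<in> V" using that E by (auto simp: simple_graph_def)
          with no that show ?thesis by blast
        qed
        have "(u, v) \<in> connected_rel V B" if "u \<in> V" "(u, v) \<in> (arcs E)\<^sup>*" for u v
          using that(2,1)
        proof (induction rule: rtrancl_induct)
          case base
          then show ?case by (simp add: connected_rel_def)
        next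
          case (step y z)
          then have "(u, y) \<in> connected_rel V B" "(y, z) \<in> connected_rel V B"
            using edge by auto
          then show ?case using equiv_connected_rel[of V B] by (meson equiv_def transD)
        qed
        then have "\<forall>u\<in>V. \<forall>v\<in>V. (u, v) \<in> connected_rel V B"
          using connected_reachable[OF conn] by blast
        then show False
          using \<open>num_components V B \<noteq> 1\<close> num_components_eq_1_iff[OF V, of B] by blast
      qed
      then obtain u v where uv: "{u, v} \<in> E" "u \<in> V" "v \<in> V" "(u, v) \<notin> connected_rel V B" by blast
      have fB: "finite B" using BE simple_graph_finite[OF E] finite_subset by blast
      have "{u, v} \<notin> B"
        using uv by (auto simp: connected_rel_def)
      then have "forest V (insert {u, v} B)"
        using num_components_insert[OF finV uv(2-4)] BE fB by (simp add: forest_def)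
      then have "insert {u, v} B = B"
        using B uv(1) BE unfolding basis_def indep by (simp add: subset_insertI)
      with \<open>{u, v} \<notin> B\<close> show False by blast
    qed
    with BE show "spanning_tree V E B" by (simp add: spanning_tree_def)
  qed
qed

definition cut_edges :: "'v set set \<Rightarrow> 'v set \<Rightarrow> 'v set set" where
  "cut_edges E X = {e \<in> E. e \<inter> X \<noteq> {} \<and> \<not> e \<subseteq> X}"

lemma connected_crosses_cut:
  assumes conn: "num_components V F = 1" and X: "X \<noteq> {}" "X \<subset> V"
  shows "cut_edges F X \<noteq> {}"
proof
  assume none: "cut_edges F X = {}"
  obtain u v where uv: "u \<in> X" "v \<in> V" "v \<notin> X" using X by blast
  have "(u, v) \<in> (arcs F)\<^sup>*"
    using uv X by (intro connected_reachable[OF conn]) auto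
  then have "v \<in> X"
  proof (induction rule: rtrancl_induct)
    case base
    then show ?case using uv by simp
  next
    case (step y z)
    then have "{y, z} \<in> F" "y \<in> X" by auto
    then show ?case using none by (auto simp: cut_edges_def)
  qed
  with uv show False by simp
qed

lemma component_cut_disjoint:
  assumes F: "simple_graph V F" and X: "X \<in> V // connected_rel V F"
  shows "cut_edges F X = {}"
proof -
  note eq = equiv_connected_rel[of V F]
  have "e \<subseteq> X" if "e \<in> F" "e \<inter> X \<noteq> {}" for e
  proof -
    obtain u v where e: "e = {u, v}" "u \<in> V" "v \<in> V"
      using simple_graph_edgeE[OF F \<open>e \<in> F\<close>] by blast
    have "(u, v) \<in> connected_rel V F" using e that by (auto simp: connected_rel_def)
    then have "u \<in> X \<longleftrightarrow> v \<in> X"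
      using X eq by (meson equiv_def in_quotient_imp_closed symD)
    with e that show ?thesis by auto
  qed
  then show ?thesis by (auto simp: cut_edges_def)
qed

lemma component_proper:
  assumes "finite V" "num_components V F \<noteq> 1" "X \<in> V // connected_rel V F"
  shows "X \<noteq> {} \<and> X \<subset> V"
proof -
  note eq = equiv_connected_rel[of V F]
  have ne: "X \<noteq> {}" using in_quotient_imp_non_empty[OF eq assms(3)] .
  have sub: "X \<subseteq> V" using in_quotient_imp_subset[OF eq assms(3)] .
  have "X \<noteq> V"
  proof
    assume "X = V"
    have "Y = X" if Y: "Y \<in> V // connected_rel V F" for Y
      using quotient_disj[OF eq Y assms(3)] in_quotient_imp_non_empty[OF eq Y]
        in_quotient_imp_subset[OF eq Y] \<open>X = V\<close> by blast
    then have "V // connected_rel V F = {X}" using assms(3) by blast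
    then show False using assms(2) by (simp add: num_components_def)
  qed
  with ne sub show ?thesis by blast
qed

text \<open>A set of edges meets all spanning trees iff its complement does not connect the graph, and
  then it contains the cut around a component of the complement.\<close>

lemma transversal_trees_iff_cut:
  assumes E: "simple_graph V E" and V: "V \<noteq> {}" and C: "C \<subseteq> E"
  shows "transversal {T. spanning_tree V E T} C \<longleftrightarrow> (\<exists>X. X \<noteq> {} \<and> X \<subset> V \<and> cut_edges E X \<subseteq> C)"
proof
  have finV: "finite V" using E by (simp add: simple_graph_def)
  have EC: "simple_graph V (E - C)" by (rule simple_graph_subset[OF E]) auto
  assume tr: "transversal {T. spanning_tree V E T} C"
  have n1: "num_components V (E - C) \<noteq> 1"
  proof
    assume "num_components V (E - C) = 1"
    then obtain T where "spanning_tree V (E - C) T" using exists_spanning_tree[OF EC] by blast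
    then have "spanning_tree V E T" "T \<inter> C = {}" by (auto simp: spanning_tree_def)
    then show False using tr by (auto simp: transversal_def)
  qed
  obtain u where "u \<in> V" using V by blast
  then have X: "connected_rel V (E - C) `` {u} \<in> V // connected_rel V (E - C)" by (rule quotientI)
  let ?X = "connected_rel V (E - C) `` {u}"
  have "cut_edges E ?X \<subseteq> C"
    using component_cut_disjoint[OF EC X] by (auto simp: cut_edges_def)
  then show "\<exists>X. X \<noteq> {} \<and> X \<subset> V \<and> cut_edges E X \<subseteq> C"
    using component_proper[OF finV n1 X] by blast
next
  assume "\<exists>X. X \<noteq> {} \<and> X \<subset> V \<and> cut_edges E X \<subseteq> C"
  then obtain X where X: "X \<noteq> {}" "X \<subset> V" "cut_edges E X \<subseteq> C" by blast
  show "transversal {T. spanning_tree V E T} C"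
    unfolding transversal_def
  proof
    fix T assume "T \<in> {T. spanning_tree V E T}"
    then have T: "T \<subseteq> E" "num_components V T = 1" by (auto simp: spanning_tree_def)
    have "cut_edges T X \<subseteq> T \<inter> C" using T(1) X(3) by (auto simp: cut_edges_def)
    then show "T \<inter> C \<noteq> {}" using connected_crosses_cut[OF T(2) X(1,2)] by blast
  qed
qed

text \<open>The cut around a component of \<open>F\<close> contains no edge of \<open>F\<close>, and every other edge lies in at
  most two of these cuts, those around the components of its ends.\<close>

lemma sum_component_cuts_le:
  fixes a :: "'v set \<Rightarrow> real"
  assumes E: "simple_graph V E" and F: "F \<subseteq> E" and a: "\<And>e. e \<in> E \<Longrightarrow> 0 \<le> a e"
  shows "(\<Sum>X\<in>V // connected_rel V F. \<Sum>e\<in>cut_edges E X. a e) \<le> 2 * (\<Sum>e\<in>E - F. a e)"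
proof -
  let ?Q = "V // connected_rel V F"
  note eq = equiv_connected_rel[of V F]
  have finV: "finite V" using E by (simp add: simple_graph_def)
  have finE: "finite E" by (rule simple_graph_finite[OF E])
  have finQ: "finite ?Q" using finV by (simp add: quotient_def)
  have cutF: "cut_edges E X = {e \<in> E - F. e \<in> cut_edges E X}" if "X \<in> ?Q" for X
    using component_cut_disjoint[OF simple_graph_subset[OF E F] that] by (auto simp: cut_edges_def)
  have two: "card {X \<in> ?Q. e \<in> cut_edges E X} \<le> 2" if "e \<in> E" for e
  proof -
    obtain u v where e: "e = {u, v}" using simple_graph_edgeE[OF E \<open>e \<in> E\<close>] by blast
    have "{X \<in> ?Q. e \<in> cut_edges E X} \<subseteq> {connected_rel V F `` {u}, connected_rel V F `` {v}}"
    proof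
      fix X assume X: "X \<in> {X \<in> ?Q. e \<in> cut_edges E X}"
      have cls: "X = connected_rel V F `` {x}" if "x \<in> X" for x
      proof -
        from X obtain x0 where x0: "X = connected_rel V F `` {x0}" by (auto elim!: quotientE)
        with that have "(x0, x) \<in> connected_rel V F" by simp
        from equiv_class_eq[OF eq this] show ?thesis using x0 by simp
      qed
      have "u \<in> X \<or> v \<in> X" using X e by (auto simp: cut_edges_def)
      with cls show "X \<in> {connected_rel V F `` {u}, connected_rel V F `` {v}}" by blast
    qed
    then have "card {X \<in> ?Q. e \<in> cut_edges E X} \<le> card {connected_rel V F `` {u}, connected_rel V F `` {v}}"
      by (intro card_mono) auto
    also have "\<dots> \<le> 2" by (simp add: card_insert_if)
    finally show ?thesis .
  qed
  have "(\<Sum>X\<in>?Q. \<Sum>e\<in>cut_edges E X. a e) = (\<Sum>X\<in>?Q. \<Sum>e | e \<in> E - F \<and> e \<in> cut_edges E X. a e)"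
    using cutF by (intro sum.cong) auto
  also have "\<dots> = (\<Sum>e\<in>E - F. \<Sum>X | X \<in> ?Q \<and> e \<in> cut_edges E X. a e)"
    using finQ finE by (intro sum.swap_restrict) auto
  also have "\<dots> \<le> (\<Sum>e\<in>E - F. 2 * a e)"
  proof (rule sum_mono)
    fix e assume "e \<in> E - F"
    then have "real (card {X \<in> ?Q. e \<in> cut_edges E X}) * a e \<le> 2 * a e"
      using two[of e] a[of e] by (intro mult_right_mono) auto
    then show "(\<Sum>X | X \<in> ?Q \<and> e \<in> cut_edges E X. a e) \<le> 2 * a e" by simp
  qed
  finally show ?thesis by (simp add: sum_distrib_left)
qed

text \<open>The hypothesis on \<open>a\<close> is a fractional form of the Nash-Williams--Tutte condition for \<open>r\<close>
  disjoint spanning trees, stated for edge sets \<open>F\<close> instead of vertex partitions. For the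
  tree \<open>T\<close> of \<open>kruskal_forest\<close>, the edges of weight at least \<open>t\<close> in \<open>T\<close> number one less than the
  components of the edges of weight below \<open>t\<close>; so by
  hypothesis the total of \<open>a\<close> over each superlevel set of \<open>w\<close> is at least \<open>r\<close> times the number of
  edges of \<open>T\<close> in it.\<close>

lemma tree_weight_le:
  fixes a w :: "'v set \<Rightarrow> real"
  assumes E: "simple_graph V E" and V: "V \<noteq> {}" and conn: "num_components V E = 1"
    and a: "\<And>F. F \<subseteq> E \<Longrightarrow> r * (real (num_components V F) - 1) \<le> (\<Sum>e\<in>E - F. a e)"
    and w: "\<And>e. e \<in> E \<Longrightarrow> 0 \<le> w e"
  shows "\<exists>T. spanning_tree V E T \<and> r * (\<Sum>e\<in>T. w e) \<le> (\<Sum>e\<in>E. a e * w e)"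
proof -
  have finE: "finite E" by (rule simple_graph_finite[OF E])
  obtain T where T: "T \<subseteq> E" "forest V T" "connected_rel V T = connected_rel V E"
    "\<And>t. connected_rel V {e \<in> T. w e < t} = connected_rel V {e \<in> E. w e < t}"
    using kruskal_forest[OF E] by blast
  have T1: "num_components V T = 1" using num_components_cong[OF T(3)] conn by simp
  have finT: "finite T" using T(1) finE finite_subset by blast
  \<comment> \<open>by the counting below, \<open>b\<close> has nonnegative sum over every superlevel set of \<open>w\<close>\<close>
  define b where "b e = a e - r * (if e \<in> T then 1 else 0)" for e
  have "0 \<le> (\<Sum>e | e \<in> E \<and> t \<le> w e. b e)" for t
  proof -
    let ?F = "{e \<in> E. w e < t}" and ?G = "{e \<in> T. w e < t}"
    have "forest V ?G"
      using forest_subset[OF simple_graph_subset[OF E T(1)] T(2)] by simp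
    then have G: "num_components V ?F + card ?G = card V"
      using num_components_cong[OF T(4)[of t]] by (simp add: forest_def)
    have "{e \<in> T. t \<le> w e} = T - ?G" by auto
    then have "card {e \<in> T. t \<le> w e} = card T - card ?G"
      using finT by (simp add: card_Diff_subset)
    moreover have "card ?G \<le> card T" using finT by (intro card_mono) auto
    moreover have "1 + card T = card V" using T(2) T1 by (simp add: forest_def)
    ultimately have card: "real (card {e \<in> T. t \<le> w e}) = real (num_components V ?F) - 1"
      using G by linarith
    have "(\<Sum>e | e \<in> E \<and> t \<le> w e. r * (if e \<in> T then 1 else 0)) = r * real (card {e \<in> T. t \<le> w e})"
    proof -
      have "{e \<in> E. t \<le> w e} \<inter> T = {e \<in> T. t \<le> w e}" using T(1) by auto
      then show ?thesis using finE by (simp add: sum_distrib_left[symmetric] sum.If_cases)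
    qed
    moreover have "{e \<in> E. t \<le> w e} = E - ?F" by auto
    ultimately show ?thesis
      using a[of ?F] card by (simp add: b_def sum_subtractf)
  qed
  then have "0 \<le> (\<Sum>e\<in>E. b e * w e)"
    by (intro level_set_sum_nonneg[where w = w and b = b, OF finE w])
  also have "(\<Sum>e\<in>E. b e * w e) = (\<Sum>e\<in>E. a e * w e) - r * (\<Sum>e\<in>T. w e)"
  proof -
    have "(\<Sum>e\<in>E. r * (if e \<in> T then 1 else 0) * w e) = (\<Sum>e\<in>E. if e \<in> T then r * w e else 0)"
      by (intro sum.cong) auto
    also have "\<dots> = r * (\<Sum>e\<in>T. w e)"
      using finE T(1) by (simp add: sum.If_cases Int_absorb1 sum_distrib_left)
    finally show ?thesis by (simp add: b_def left_diff_distrib sum_subtractf)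
  qed
  finally show ?thesis using T(1,2) T1 by (auto simp: spanning_tree_def)
qed

text \<open>For \<open>a\<close> and \<open>s\<close> with natural values this says that the monomial with exponent vector \<open>a\<close> lies in the
  symbolic power with exponent \<open>s\<close>. Real \<open>a\<close> and \<open>s\<close> make the condition scale.\<close>

definition cut_feasible :: "'v set \<Rightarrow> 'v set set \<Rightarrow> real \<Rightarrow> ('v set \<Rightarrow> real) \<Rightarrow> bool" where
  "cut_feasible V E s a \<longleftrightarrow> (\<forall>e\<in>E. 0 \<le> a e) \<and>
     (\<forall>X. X \<noteq> {} \<longrightarrow> X \<subset> V \<longrightarrow> s \<le> (\<Sum>e\<in>cut_edges E X. a e))"

definition cut_lp_value :: "'v set \<Rightarrow> 'v set set \<Rightarrow> real" where
  "cut_lp_value V E = Inf {\<Sum>e\<in>E. a e | a. cut_feasible V E 1 a}"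

text \<open>As \<open>(c - 1) / c\<close> increases with \<open>c\<close>, the largest number of components is the critical
  one.\<close>

lemma partition_ratio_bound:
  fixes c :: nat and N s A :: real
  assumes "2 \<le> c" "real c \<le> N" "real c * s \<le> 2 * A" "0 \<le> A"
  shows "s * (real c - 1) \<le> (2 - 2 / N) * A"
proof -
  have c: "0 < real c" using assms(1) by simp
  have "s * (real c - 1) = (real c * s) * ((real c - 1) / real c)"
    using c by simp
  also have "\<dots> \<le> (2 * A) * ((real c - 1) / real c)"
    using assms by (intro mult_right_mono) auto
  also have "\<dots> = (2 - 2 / real c) * A"
    using c by (simp add: field_simps)
  also have "\<dots> \<le> (2 - 2 / N) * A"
    using assms c by (intro mult_right_mono diff_left_mono divide_left_mono) auto
  finally show ?thesis .
qed

section \<open>The ideal of spanning trees\<close>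

locale connected_simple_graph =
  fixes V :: "'v set" and E :: "'v set set"
  assumes simple: "simple_graph V E"
    and nonempty: "V \<noteq> {}"
    and conn: "num_components V E = 1"
begin

abbreviation trees :: "'v set set set" where
  "trees \<equiv> {T. spanning_tree V E T}"

lemma finV: "finite V"
  using simple by (simp add: simple_graph_def)

lemma finE: "finite E"
  by (rule simple_graph_finite[OF simple])

lemma tree_subset: "T \<in> trees \<Longrightarrow> T \<subseteq> E"
  by (simp add: spanning_tree_def)

lemma fin_trees: "finite trees"
  by (rule finite_subset[of _ "Pow E"]) (auto simp: finE spanning_tree_def)

lemma card_tree: "T \<in> trees \<Longrightarrow> card T = card V - 1"
  by (auto simp: spanning_tree_def forest_def)

lemma facet_ideal_trees:
  "facet_ideal (graphic_matroid E) =
    (monomial_span (cover_monomials E trees) :: ('v set, 'k::field) mpoly set)"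
  using facet_ideal_eq[of "graphic_matroid E"] finE
  by (simp add: ground_def graphic_matroid_def basis_graphic_iff[OF simple nonempty conn, unfolded graphic_matroid_def])

definition cut_monomials :: "nat \<Rightarrow> ('v set \<Rightarrow>\<^sub>0 nat) set" where
  "cut_monomials s = {m \<in> monomials E. cut_feasible V E (real s) (\<lambda>e. real (lookup m e))}"

lemma symbolic_power_trees:
  "symbolic_power (poly_ring E) (facet_ideal (graphic_matroid E)) s =
    (monomial_span (cut_monomials s) :: ('v set, 'k::field) mpoly set)"
proof -
  have "(\<forall>C\<subseteq>E. transversal trees C \<longrightarrow> s \<le> (\<Sum>e\<in>C. lookup m e)) \<longleftrightarrow>
      cut_feasible V E (real s) (\<lambda>e. real (lookup m e))" for m
  proof
    assume L: "\<forall>C\<subseteq>E. transversal trees C \<longrightarrow> s \<le> (\<Sum>e\<in>C. lookup m e)"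
    show "cut_feasible V E (real s) (\<lambda>e. real (lookup m e))"
      unfolding cut_feasible_def
    proof (intro conjI allI impI ballI)
      fix X assume X: "X \<noteq> {}" "X \<subset> V"
      have sub: "cut_edges E X \<subseteq> E" by (auto simp: cut_edges_def)
      have "transversal trees (cut_edges E X)"
        using transversal_trees_iff_cut[OF simple nonempty sub] X by blast
      then have "s \<le> (\<Sum>e\<in>cut_edges E X. lookup m e)" using L sub by blast
      then show "real s \<le> (\<Sum>e\<in>cut_edges E X. real (lookup m e))"
        by (metis of_nat_le_iff of_nat_sum)
    qed simp
  next
    assume R: "cut_feasible V E (real s) (\<lambda>e. real (lookup m e))"
    show "\<forall>C\<subseteq>E. transversal trees C \<longrightarrow> s \<le> (\<Sum>e\<in>C. lookup m e)"
    proof (intro allI impI)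
      fix C assume C: "C \<subseteq> E" "transversal trees C"
      obtain X where X: "X \<noteq> {}" "X \<subset> V" "cut_edges E X \<subseteq> C"
        using transversal_trees_iff_cut[OF simple nonempty C(1)] C(2) by blast
      have "real s \<le> (\<Sum>e\<in>cut_edges E X. real (lookup m e))"
        using R X by (simp add: cut_feasible_def)
      also have "\<dots> \<le> (\<Sum>e\<in>C. real (lookup m e))"
        using X(3) finite_subset[OF C(1) finE] by (intro sum_mono2) auto
      finally show "s \<le> (\<Sum>e\<in>C. lookup m e)" by (metis of_nat_le_iff of_nat_sum)
    qed
  qed
  then show ?thesis
    unfolding facet_ideal_trees cut_monomials_def
    by (subst symbolic_power_cover[OF finE tree_subset]) auto
qed

lemma ideal_power_trees:
  "ideal_power (poly_ring E) (facet_ideal (graphic_matroid E)) r =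
    (monomial_span (monomial_power E (cover_monomials E trees) r) :: ('v set, 'k::field) mpoly set)"
  unfolding facet_ideal_trees by (rule ideal_power_monomial_span)

lemma num_components_le_card: "num_components V F \<le> card V"
proof -
  have "V // connected_rel V F = (\<lambda>x. connected_rel V F `` {x}) ` V" by (auto simp: quotient_def)
  then show ?thesis by (simp add: num_components_def card_image_le finV)
qed

lemma num_components_eq_card_imp_empty:
  assumes F: "F \<subseteq> E" and n: "num_components V F = card V"
  shows "F = {}"
proof (rule ccontr)
  assume "F \<noteq> {}"
  then obtain e where e: "e \<in> F" by blast
  obtain u v where uv: "e = {u, v}" "u \<in> V" "v \<in> V" "u \<noteq> v"
    using simple_graph_edgeE[OF simple, of e] e F by blast
  let ?f = "\<lambda>x. connected_rel V F `` {x}"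
  have "V // connected_rel V F = ?f ` V" by (auto simp: quotient_def)
  then have "inj_on ?f V"
    using n finV by (intro eq_card_imp_inj_on) (simp_all add: num_components_def)
  moreover have "(u, v) \<in> arcs F" using e uv by simp
  then have "(u, v) \<in> connected_rel V F"
    using uv by (simp add: connected_rel_def r_into_rtrancl)
  then have "?f u = ?f v" by (rule equiv_class_eq[OF equiv_connected_rel])
  ultimately show False using uv by (auto dest: inj_onD)
qed

text \<open>With at least two components, each component is a proper nonempty vertex set, so the cut around
  it has weight at least \<open>s\<close>. Sum these bounds.\<close>

lemma components_weight_le:
  assumes a: "cut_feasible V E s a" and F: "F \<subseteq> E" and n: "num_components V F \<noteq> 1"
  shows "real (num_components V F) * s \<le> 2 * (\<Sum>e\<in>E - F. a e)"
proof -
  let ?Q = "V // connected_rel V F"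
  have "real (num_components V F) * s = (\<Sum>X\<in>?Q. s)" by (simp add: num_components_def)
  also have "\<dots> \<le> (\<Sum>X\<in>?Q. \<Sum>e\<in>cut_edges E X. a e)"
  proof (rule sum_mono)
    fix X assume "X \<in> ?Q"
    then have "X \<noteq> {} \<and> X \<subset> V" by (rule component_proper[OF finV n])
    then show "s \<le> (\<Sum>e\<in>cut_edges E X. a e)" using a by (simp add: cut_feasible_def)
  qed
  also have "\<dots> \<le> 2 * (\<Sum>e\<in>E - F. a e)"
    using a by (intro sum_component_cuts_le[OF simple F]) (simp add: cut_feasible_def)
  finally show ?thesis .
qed

text \<open>The bound is the hypothesis of \<open>tree_weight_le\<close> with \<open>s / K\<close> trees, so duality packs this many
  trees fractionally into each exponent vector of the symbolic power; the second
  summand in the size condition pays for rounding.\<close>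

lemma symbolic_power_subset_power:
  fixes K :: real
  assumes K: "0 < K"
    and bound: "\<And>a s F. cut_feasible V E s a \<Longrightarrow> 0 \<le> s \<Longrightarrow> F \<subseteq> E \<Longrightarrow>
      s * (real (num_components V F) - 1) \<le> K * (\<Sum>e\<in>E - F. a e)"
    and size: "real r + real (card trees) \<le> real s / K"
  shows "symbolic_power (poly_ring E) (facet_ideal (graphic_matroid E)) s \<subseteq>
    (ideal_power (poly_ring E) (facet_ideal (graphic_matroid E)) r :: ('v set, 'k::field) mpoly set)"
proof -
  have "m \<in> monomial_power E (cover_monomials E trees) r" if m: "m \<in> cut_monomials s" for m
  proof -
    have feas: "cut_feasible V E (real s) (\<lambda>e. real (lookup m e))" and mE: "m \<in> monomials E"
      using m by (simp_all add: cut_monomials_def)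
    have "\<exists>T. spanning_tree V E T \<and>
        real s / K * (\<Sum>e\<in>T. w e) \<le> (\<Sum>e\<in>E. real (lookup m e) * w e)"
      if w: "\<And>e. e \<in> E \<Longrightarrow> 0 \<le> w e" for w :: "'v set \<Rightarrow> real"
    proof (rule tree_weight_le[OF simple nonempty conn _ w])
      fix F assume "F \<subseteq> E"
      then show "real s / K * (real (num_components V F) - 1) \<le> (\<Sum>e\<in>E - F. real (lookup m e))"
        using bound[OF feas] K by (simp add: field_simps)
    qed
    then have "\<exists>T\<in>trees. real s / K * (\<Sum>e\<in>T. w e) \<le> (\<Sum>e\<in>E. real (lookup m e) * w e)"
      if "\<And>e. e \<in> E \<Longrightarrow> 0 \<le> w e" for w :: "'v set \<Rightarrow> real"
      using that by blast
    from fractional_packing_floor[OF finE fin_trees tree_subset this] obtain c :: "'v set set \<Rightarrow> nat"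
      where c: "real s / K - real (card trees) \<le> real (sum c trees)"
        "\<forall>e\<in>E. (\<Sum>T | T \<in> trees \<and> e \<in> T. c T) \<le> lookup m e"
      using K by auto
    have "r \<le> sum c trees" using c(1) size by linarith
    then show ?thesis
      using c(2) by (intro monomial_powerI[OF finE fin_trees tree_subset mE]) auto
  qed
  then show ?thesis
    unfolding symbolic_power_trees ideal_power_trees monomial_span_def by blast
qed

text \<open>If \<open>s / r > K\<close>, then \<open>s * t / K\<close> exceeds \<open>r * t\<close> by an amount that grows linearly in \<open>t\<close>, and
  eventually by more than the number of spanning trees.\<close>

lemma asymptotic_resurgence_le:
  fixes K :: real
  assumes K: "0 < K"
    and bound: "\<And>a s F. cut_feasible V E s a \<Longrightarrow> 0 \<le> s \<Longrightarrow> F \<subseteq> E \<Longrightarrow>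
      s * (real (num_components V F) - 1) \<le> K * (\<Sum>e\<in>E - F. a e)"
  shows "asymptotic_resurgence (poly_ring E :: ('v set, 'k::field) mpoly ring)
    (facet_ideal (graphic_matroid E)) \<le> ereal K"
  unfolding asymptotic_resurgence_def
proof (rule Sup_least, clarify)
  fix s r :: nat
  let ?P = "\<lambda>t. symbolic_power (poly_ring E :: ('v set, 'k) mpoly ring) (facet_ideal (graphic_matroid E)) (s * t)
      \<subseteq> ideal_power (poly_ring E) (facet_ideal (graphic_matroid E)) (r * t)"
  assume sr: "0 < s" "0 < r" and ev: "\<forall>\<^sub>F t in sequentially. \<not> ?P t"
  have "real s / real r \<le> K"
  proof (rule ccontr)
    assume "\<not> real s / real r \<le> K"
    then have gap: "0 < real s / K - real r" using sr K by (simp add: field_simps)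
    obtain N :: nat where N: "real (card trees) / (real s / K - real r) \<le> real N"
      using real_arch_simple by blast
    have "?P t" if "N \<le> t" for t
    proof (rule symbolic_power_subset_power[OF K bound])
      have "real (card trees) / (real s / K - real r) \<le> real t"
        using N that by linarith
      then have "real (card trees) \<le> real t * (real s / K - real r)"
        using gap by (simp add: pos_divide_le_eq)
      then show "real (r * t) + real (card trees) \<le> real (s * t) / K"
        by (simp add: algebra_simps)
    qed
    then have "\<forall>\<^sub>F t in sequentially. ?P t"
      unfolding eventually_sequentially by blast
    with ev have "\<forall>\<^sub>F t in sequentially. False"
      by eventually_elim blast
    then show False by simp
  qed
  then show "ereal (real s / real r) \<le> ereal K" by simp
qed

section \<open>The Waldschmidt constant\<close>

lemma cut_feasible_scale:
  assumes "cut_feasible V E s a" "0 < s"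
  shows "cut_feasible V E 1 (\<lambda>e. a e / s)"
  using assms by (auto simp: cut_feasible_def sum_divide_distrib[symmetric])

lemma cut_lp_value_le:
  assumes "cut_feasible V E 1 a"
  shows "cut_lp_value V E \<le> (\<Sum>e\<in>E. a e)"
  unfolding cut_lp_value_def
proof (rule cInf_lower)
  show "bdd_below {\<Sum>e\<in>E. a e | a. cut_feasible V E 1 a}"
    by (rule bdd_belowI[of _ 0]) (auto simp: cut_feasible_def intro!: sum_nonneg)
qed (use assms in blast)

lemma cut_lp_value_mult_le:
  assumes "cut_feasible V E s a" "0 \<le> s"
  shows "cut_lp_value V E * s \<le> (\<Sum>e\<in>E. a e)"
proof (cases "s = 0")
  case True
  then show ?thesis using assms by (auto simp: cut_feasible_def intro: sum_nonneg)
next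
  case False
  then have s: "0 < s" using assms by simp
  have "cut_lp_value V E \<le> (\<Sum>e\<in>E. a e / s)"
    by (rule cut_lp_value_le[OF cut_feasible_scale[OF assms(1) s]])
  then show ?thesis using s by (simp add: sum_divide_distrib[symmetric] pos_le_divide_eq)
qed

lemma cut_feasible_one: "cut_feasible V E 1 (\<lambda>e. 1)"
  unfolding cut_feasible_def
proof (intro conjI allI impI ballI)
  fix X assume X: "X \<noteq> {}" "X \<subset> V"
  have "finite (cut_edges E X)" using finE by (simp add: cut_edges_def)
  then have "0 < card (cut_edges E X)"
    using connected_crosses_cut[OF conn X] by (simp add: card_gt_0_iff)
  then show "(1::real) \<le> (\<Sum>e\<in>cut_edges E X. 1)" by simp
qed simp

text \<open>Rounding up \<open>s * a\<close> keeps the cut conditions and costs less than 1 per edge.\<close>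

lemma cut_monomial_of_weights:
  assumes "cut_feasible V E 1 a"
  shows "\<exists>m\<in>cut_monomials s. real (mon_degree m) \<le> real s * (\<Sum>e\<in>E. a e) + real (card E)"
proof -
  define k where "k e = nat \<lceil>real s * a e\<rceil>" for e
  define m where "m = (\<Sum>e\<in>E. single e (k e))"
  have lk: "lookup m e = (if e \<in> E then k e else 0)" for e
    using finE by (simp add: m_def lookup_sum lookup_single when_def)
  have a: "0 \<le> a e" if "e \<in> E" for e using assms that by (simp add: cut_feasible_def)
  have k: "real s * a e \<le> real (k e)" "real (k e) \<le> real s * a e + 1" if "e \<in> E" for e
  proof -
    have "0 \<le> real s * a e" using a[OF that] by simp
    then show "real s * a e \<le> real (k e)" "real (k e) \<le> real s * a e + 1"
      unfolding k_def by linarith+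
  qed
  have mE: "m \<in> monomials E"
    by (auto simp: monomials_def in_keys_iff lk split: if_splits)
  have "cut_feasible V E (real s) (\<lambda>e. real (lookup m e))"
    unfolding cut_feasible_def
  proof (intro conjI allI impI ballI)
    fix X assume X: "X \<noteq> {}" "X \<subset> V"
    have "real s * 1 \<le> real s * (\<Sum>e\<in>cut_edges E X. a e)"
      using assms X by (intro mult_left_mono) (auto simp: cut_feasible_def)
    also have "\<dots> \<le> (\<Sum>e\<in>cut_edges E X. real (lookup m e))"
      unfolding sum_distrib_left using k by (intro sum_mono) (auto simp: lk cut_edges_def)
    finally show "real s \<le> (\<Sum>e\<in>cut_edges E X. real (lookup m e))" by simp
  qed simp
  with mE have "m \<in> cut_monomials s" by (simp add: cut_monomials_def)
  moreover have "real (mon_degree m) = (\<Sum>e\<in>E. real (k e))"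
    using mon_degree_eq_sum[OF finE mE] by (simp add: lk)
  moreover have "(\<Sum>e\<in>E. real (k e)) \<le> (\<Sum>e\<in>E. real s * a e + 1)"
    using k by (intro sum_mono) auto
  ultimately show ?thesis
    by (intro bexI[of _ m]) (simp_all add: sum.distrib sum_distrib_left)
qed

abbreviation symbolic_degree :: "'k::field itself \<Rightarrow> nat \<Rightarrow> nat" where
  "symbolic_degree _ s \<equiv> initial_degree (symbolic_power (poly_ring E)
    (facet_ideal (graphic_matroid E)) s :: ('v set, 'k) mpoly set)"

lemma symbolic_degree_attained:
  obtains m where "m \<in> cut_monomials s"
    "symbolic_degree TYPE('k::field) s = mon_degree m"
proof -
  have "cut_monomials s \<noteq> {}" using cut_monomial_of_weights[OF cut_feasible_one] by blast
  then obtain m where "m \<in> cut_monomials s"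
      "initial_degree (monomial_span (cut_monomials s) :: ('v set, 'k) mpoly set) = mon_degree m"
    by (rule initial_degree_attained)
  then show thesis
    by (intro that) (simp_all add: symbolic_power_trees)
qed

text \<open>The degrees lie between \<open>s\<close> times the value of the linear program and \<open>s\<close> times the total weight
  of any feasible point plus the constant \<open>card E\<close>.\<close>

lemma symbolic_degree_limit:
  "(\<lambda>s. real (symbolic_degree TYPE('k::field) s) / real s) \<longlonglongrightarrow> cut_lp_value V E"
proof (rule order_tendstoI)
  fix y assume y: "y < cut_lp_value V E"
  have "y < real (symbolic_degree TYPE('k) s) / real s" if s: "1 \<le> s" for s
  proof -
    obtain m where m: "m \<in> cut_monomials s" "symbolic_degree TYPE('k) s = mon_degree m"
      by (rule symbolic_degree_attained)
    have "cut_lp_value V E * real s \<le> (\<Sum>e\<in>E. real (lookup m e))"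
      using m(1) by (intro cut_lp_value_mult_le) (simp_all add: cut_monomials_def)
    also have "\<dots> = real (mon_degree m)"
      using mon_degree_eq_sum[OF finE, of m] m(1) by (simp add: cut_monomials_def)
    finally have "cut_lp_value V E \<le> real (symbolic_degree TYPE('k) s) / real s"
      using s m(2) by (simp add: pos_le_divide_eq)
    with y show ?thesis by simp
  qed
  then show "\<forall>\<^sub>F s in sequentially. y < real (symbolic_degree TYPE('k) s) / real s"
    unfolding eventually_sequentially by blast
next
  fix y assume y: "cut_lp_value V E < y"
  have "{\<Sum>e\<in>E. a e | a. cut_feasible V E 1 a} \<noteq> {}"
    using cut_feasible_one by blast
  then obtain a where a: "cut_feasible V E 1 a" "(\<Sum>e\<in>E. a e) < y"
    using cInf_lessD[of "{\<Sum>e\<in>E. a e | a. cut_feasible V E 1 a}" y] y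
    unfolding cut_lp_value_def by blast
  have "(\<lambda>s. (\<Sum>e\<in>E. a e) + real (card E) / real s) \<longlonglongrightarrow> (\<Sum>e\<in>E. a e) + 0"
    by (intro tendsto_add tendsto_const lim_const_over_n)
  then have ev: "\<forall>\<^sub>F s in sequentially. (\<Sum>e\<in>E. a e) + real (card E) / real s < y"
    using a(2) by (intro order_tendstoD) simp_all
  have le: "real (symbolic_degree TYPE('k) s) / real s \<le> (\<Sum>e\<in>E. a e) + real (card E) / real s"
    if s: "1 \<le> s" for s
  proof -
    obtain m where m: "m \<in> cut_monomials s"
        "real (mon_degree m) \<le> real s * (\<Sum>e\<in>E. a e) + real (card E)"
      using cut_monomial_of_weights[OF a(1)] by blast
    have "symbolic_degree TYPE('k) s \<le> mon_degree m"
      unfolding symbolic_power_trees by (rule initial_degree_le[OF m(1)])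
    then have "real (symbolic_degree TYPE('k) s) \<le> real s * (\<Sum>e\<in>E. a e) + real (card E)"
      using m(2) by linarith
    then have "real (symbolic_degree TYPE('k) s) / real s \<le> (real s * (\<Sum>e\<in>E. a e) + real (card E)) / real s"
      by (intro divide_right_mono) simp_all
    then show ?thesis using s by (simp add: add_divide_distrib)
  qed
  show "\<forall>\<^sub>F s in sequentially. real (symbolic_degree TYPE('k) s) / real s < y"
    using ev eventually_ge_at_top[of 1] by eventually_elim (use le in force)
qed

lemma waldschmidt_eq_cut_lp_value:
  "waldschmidt (poly_ring E :: ('v set, 'k::field) mpoly ring) (facet_ideal (graphic_matroid E)) =
    cut_lp_value V E"
  unfolding waldschmidt_def by (rule limI[OF symbolic_degree_limit])

text \<open>The stars of the vertices are cuts, and every edge lies in two stars. They are the cuts around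
  the components of the graph without edges.\<close>

lemma cut_lp_value_ge:
  assumes "2 \<le> card V"
  shows "real (card V) / 2 \<le> cut_lp_value V E"
  unfolding cut_lp_value_def
proof (rule cInf_greatest)
  show "{\<Sum>e\<in>E. a e | a. cut_feasible V E 1 a} \<noteq> {}" using cut_feasible_one by blast
  fix x assume "x \<in> {\<Sum>e\<in>E. a e | a. cut_feasible V E 1 a}"
  then obtain a where a: "x = (\<Sum>e\<in>E. a e)" "cut_feasible V E 1 a" by blast
  show "real (card V) / 2 \<le> x"
    using components_weight_le[OF a(2), of "{}"] assms by (simp add: num_components_empty a(1))
qed

section \<open>Bounds for the asymptotic resurgence\<close>

lemma asymptotic_resurgence_upper:
  assumes n: "2 \<le> card V"
  shows "asymptotic_resurgence (poly_ring E :: ('v set, 'k::field) mpoly ring)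
    (facet_ideal (graphic_matroid E)) \<le> ereal (2 - 2 / real (card V))"
proof (rule asymptotic_resurgence_le)
  have "2 / real (card V) \<le> 1" using n by simp
  then show K: "0 < 2 - 2 / real (card V)" by linarith
  fix a s F assume a: "cut_feasible V E s a" and s: "0 \<le> s" and F: "F \<subseteq> E"
  have A: "0 \<le> (\<Sum>e\<in>E - F. a e)" using a by (auto simp: cut_feasible_def intro: sum_nonneg)
  show "s * (real (num_components V F) - 1) \<le> (2 - 2 / real (card V)) * (\<Sum>e\<in>E - F. a e)"
  proof (cases "num_components V F = 1")
    case True
    then show ?thesis using A K by simp
  next
    case False
    then have "2 \<le> num_components V F" using num_components_pos[OF finV nonempty, of F] by linarith
    then show ?thesis
      using components_weight_le[OF a F False] A num_components_le_card[of F]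
      by (intro partition_ratio_bound) simp_all
  qed
qed

text \<open>The constant \<open>2 - 2 / card V\<close> is needed only for edge sets \<open>F\<close> with \<open>card V\<close> components. The only
  such set is empty, and for it the bound by the value of the linear program is better; all
  other sets satisfy the estimate with \<open>card V - 1\<close> in place of \<open>card V\<close>.\<close>

lemma asymptotic_resurgence_strict:
  assumes n: "3 \<le> card V" and mu: "real (card V) / 2 < cut_lp_value V E"
  shows "asymptotic_resurgence (poly_ring E :: ('v set, 'k::field) mpoly ring)
    (facet_ideal (graphic_matroid E)) < ereal (2 - 2 / real (card V))"
proof -
  define n' where "n' = real (card V)"
  have n': "3 \<le> n'" using n by (simp add: n'_def)
  define \<mu> where "\<mu> = cut_lp_value V E"
  have mu': "n' / 2 < \<mu>" "0 < \<mu>" using mu n' by (simp_all add: n'_def \<mu>_def)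
  \<comment> \<open>the first constant serves fewer than \<open>card V\<close> components, the second one the empty edge set\<close>
  define K where "K = max (2 - 2 / (n' - 1)) ((n' - 1) / \<mu>)"
  have K1: "0 < (n' - 1) / \<mu>" using n' mu' by simp
  then have K0: "0 < K" by (simp add: K_def)
  have "asymptotic_resurgence (poly_ring E :: ('v set, 'k::field) mpoly ring)
    (facet_ideal (graphic_matroid E)) \<le> ereal K"
  proof (rule asymptotic_resurgence_le[OF K0])
    fix a s F assume a: "cut_feasible V E s a" and s: "0 \<le> s" and F: "F \<subseteq> E"
    have A: "0 \<le> (\<Sum>e\<in>E - F. a e)" using a by (auto simp: cut_feasible_def intro: sum_nonneg)
    consider "num_components V F = 1" | "num_components V F = card V" "num_components V F \<noteq> 1"
      | "2 \<le> num_components V F" "num_components V F \<le> card V - 1"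
      using num_components_pos[OF finV nonempty, of F] num_components_le_card[of F] by linarith
    then show "s * (real (num_components V F) - 1) \<le> K * (\<Sum>e\<in>E - F. a e)"
    proof cases
      case 1
      then show ?thesis using A K0 by simp
    next
      case 2
      have "F = {}" by (rule num_components_eq_card_imp_empty[OF F 2(1)])
      have "s * (n' - 1) = (n' - 1) / \<mu> * (\<mu> * s)" using mu' by simp
      also have "\<dots> \<le> (n' - 1) / \<mu> * (\<Sum>e\<in>E. a e)"
        using cut_lp_value_mult_le[OF a s] K1 by (intro mult_left_mono) (simp_all add: \<mu>_def)
      also have "\<dots> \<le> K * (\<Sum>e\<in>E. a e)"
        using A \<open>F = {}\<close> by (intro mult_right_mono) (simp_all add: K_def)
      finally show ?thesis using 2 \<open>F = {}\<close> by (simp add: n'_def)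
    next
      case 3
      have "s * (real (num_components V F) - 1) \<le> (2 - 2 / (n' - 1)) * (\<Sum>e\<in>E - F. a e)"
        using components_weight_le[OF a F] A 3 n
        by (intro partition_ratio_bound) (simp_all add: n'_def of_nat_diff)
      also have "\<dots> \<le> K * (\<Sum>e\<in>E - F. a e)"
        using A by (intro mult_right_mono) (simp_all add: K_def)
      finally show ?thesis .
    qed
  qed
  also have "ereal K < ereal (2 - 2 / n')"
  proof -
    have "2 / n' < 2 / (n' - 1)" using n' by (intro divide_strict_left_mono) auto
    moreover have "(n' - 1) / \<mu> < (n' - 1) / (n' / 2)"
      using mu' n' by (intro divide_strict_left_mono) auto
    moreover have "(n' - 1) / (n' / 2) = 2 - 2 / n'" using n' by (simp add: field_simps)
    ultimately show ?thesis by (simp add: K_def)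
  qed
  finally show ?thesis by (simp add: n'_def)
qed

text \<open>A comparison of degrees: if \<open>s / r\<close> is less than the bound, then for large \<open>t\<close> the symbolic
  power with exponent \<open>s * t\<close> contains a monomial of degree about \<open>s * t * card V / 2\<close>. This
  is less than \<open>r * t * (card V - 1)\<close>, the least degree in the ordinary power.\<close>

lemma asymptotic_resurgence_lower:
  assumes n: "2 \<le> card V" and mu: "cut_lp_value V E = real (card V) / 2"
  shows "ereal (2 - 2 / real (card V)) \<le> asymptotic_resurgence
    (poly_ring E :: ('v set, 'k::field) mpoly ring) (facet_ideal (graphic_matroid E))"
    (is "_ \<le> ?\<rho>")
proof (rule ccontr)
  assume "\<not> ?thesis"
  then have "?\<rho> < ereal (2 - 2 / real (card V))" by simp
  then obtain z where z: "?\<rho> < ereal z" "z < 2 - 2 / real (card V)"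
    using ereal_dense2[of ?\<rho> "ereal (2 - 2 / real (card V))"] by auto
  have "2 / real (card V) \<le> 1" using n by simp
  then have "max z 0 < 2 - 2 / real (card V)" using z(2) by simp
  then obtain q where q: "q \<in> \<rat>" "max z 0 < q" "q < 2 - 2 / real (card V)"
    using Rats_dense_in_real by blast
  obtain s r :: nat where sr: "r \<noteq> 0" "\<bar>q\<bar> = real s / real r"
    using Rats_abs_nat_div_natE[OF q(1)] by blast
  have q_eq: "q = real s / real r" using sr q(2) by simp
  have s0: "0 < s" using q_eq q(2) by (cases "s = 0") auto
  have r0: "0 < r" using sr by simp
  let ?P = "\<lambda>t. symbolic_power (poly_ring E :: ('v set, 'k) mpoly ring) (facet_ideal (graphic_matroid E)) (s * t)
      \<subseteq> ideal_power (poly_ring E) (facet_ideal (graphic_matroid E)) (r * t)"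
  have "real (card V) / 2 < real r * (real (card V) - 1) / real s"
    using q(3) s0 r0 n unfolding q_eq by (simp add: field_simps)
  then have ev0: "\<forall>\<^sub>F k in sequentially. real (symbolic_degree TYPE('k) k) / real k
      < real r * (real (card V) - 1) / real s"
    using symbolic_degree_limit[where ?'k = 'k] unfolding mu by (intro order_tendstoD)
  have "filterlim (\<lambda>t. s * t) sequentially sequentially"
    using s0 by (intro filterlim_subseq) (simp add: strict_mono_def)
  from eventually_compose_filterlim[OF ev0 this]
  have "\<forall>\<^sub>F t in sequentially. \<not> ?P t"
    using eventually_ge_at_top[of 1]
  proof eventually_elim
    case (elim t)
    obtain m where m: "m \<in> cut_monomials (s * t)"
        "symbolic_degree TYPE('k) (s * t) = mon_degree m"
      by (rule symbolic_degree_attained)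
    have "real (mon_degree m) < real (r * t * (card V - 1))"
      using elim m(2) s0 n by (simp add: field_simps of_nat_diff)
    then have small: "mon_degree m < r * t * (card V - 1)" by (simp only: of_nat_less_iff)
    have notin: "m \<notin> monomial_power E (cover_monomials E trees) (r * t)"
    proof
      assume "m \<in> monomial_power E (cover_monomials E trees) (r * t)"
      then have "r * t * (card V - 1) \<le> mon_degree m"
        by (rule degree_monomial_power[OF finE, rotated]) (simp add: card_tree)
      with small show False by simp
    qed
    have "(single m 1 :: ('v set, 'k) mpoly) \<in> monomial_span (cut_monomials (s * t))"
      using m(1) by (rule single_in_monomial_span)
    moreover have "(single m 1 :: ('v set, 'k) mpoly) \<notin>
        monomial_span (monomial_power E (cover_monomials E trees) (r * t))"
      using notin by (simp add: monomial_span_def)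
    ultimately show "\<not> ?P t"
      unfolding symbolic_power_trees ideal_power_trees by blast
  qed
  then have "ereal q \<le> ?\<rho>"
    unfolding asymptotic_resurgence_def q_eq using s0 r0 by (intro Sup_upper) blast
  also have "?\<rho> < ereal z" by (rule z(1))
  finally show False using q(2) by simp
qed

section \<open>Graphs attaining the bound\<close>

lemma cut_lp_value_eqI:
  assumes "2 \<le> card V" "cut_feasible V E 1 a" "(\<Sum>e\<in>E. a e) \<le> real (card V) / 2"
  shows "cut_lp_value V E = real (card V) / 2"
  using cut_lp_value_le[OF assms(2)] cut_lp_value_ge[OF assms(1)] assms(3) by linarith

text \<open>Every cut contains a bond, hence has at least \<open>d\<close> edges, where \<open>d\<close> is the common degree and
  the edge connectivity. So the constant weight \<open>1 / d\<close> is feasible, and its total is \<open>card V / 2\<close> by double counting.\<close>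

lemma regular_cut_lp_value:
  assumes n: "2 \<le> card V" and reg: "regular_graph V E"
    and lam: "edge_connectivity V E = min_degree V E"
  shows "cut_lp_value V E = real (card V) / 2"
proof -
  obtain d where d: "\<And>v. v \<in> V \<Longrightarrow> degree E v = d"
    using reg by (auto simp: regular_graph_def)
  have "degree E ` V = {d}" using d nonempty by auto
  then have lam_d: "edge_connectivity V E = d" using lam by (simp add: min_degree_def)
  have cut_card: "d \<le> card (cut_edges E X)" if X: "X \<noteq> {}" "X \<subset> V" for X
  proof -
    let ?C = "cut_edges E X"
    have fC: "finite ?C" using finE by (simp add: cut_edges_def)
    have "cut_edges (E - ?C) X = {}" by (auto simp: cut_edges_def)
    then have "num_components V (E - ?C) \<noteq> 1" using connected_crosses_cut X by blast
    then have "edge_cut V E ?C"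
      using num_components_pos[OF finV nonempty, of "E - ?C"] conn
      by (auto simp: edge_cut_def cut_edges_def)
    then have "?C \<in> {B. B \<subseteq> ?C \<and> edge_cut V E B}" by simp
    moreover have "finite {B. B \<subseteq> ?C \<and> edge_cut V E B}" using fC by simp
    ultimately obtain B where B: "B \<subseteq> ?C" "edge_cut V E B"
      and min: "\<And>B'. B' \<subseteq> ?C \<Longrightarrow> edge_cut V E B' \<Longrightarrow> B' \<subseteq> B \<Longrightarrow> B = B'"
      using finite_has_minimal2[of "{B. B \<subseteq> ?C \<and> edge_cut V E B}" ?C] by auto
    have "bond V E B"
      unfolding bond_def
    proof (intro conjI allI impI notI)
      fix B' assume "B' \<subset> B" "edge_cut V E B'"
      then show False using min[of B'] B(1) by blast
    qed (rule B(2))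
    moreover have "finite {B. bond V E B}"
      by (rule finite_subset[of _ "Pow E"]) (auto simp: finE bond_def edge_cut_def)
    ultimately have "d \<le> card B"
      unfolding lam_d[symmetric] edge_connectivity_def by (intro Min_le) auto
    also have "\<dots> \<le> card ?C" by (rule card_mono[OF fC B(1)])
    finally show ?thesis .
  qed
  have d0: "0 < d"
  proof -
    obtain u where u: "u \<in> V" using nonempty by blast
    have "{u} \<noteq> V" using n by (cases "V = {u}") auto
    then have "cut_edges E {u} \<noteq> {}" using u by (intro connected_crosses_cut[OF conn]) auto
    then have "{e \<in> E. u \<in> e} \<noteq> {}" by (auto simp: cut_edges_def)
    then show ?thesis using d[OF u] finE by (auto simp: degree_def card_gt_0_iff)
  qed
  have "card V * d = (\<Sum>v\<in>V. card {e \<in> E. v \<in> e})"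
    using d by (simp add: degree_def)
  also have "\<dots> = 2 * card E"
  proof (rule sum_multicount[OF finV finE])
    show "\<forall>e\<in>E. card {v \<in> V. v \<in> e} = 2"
    proof
      fix e assume "e \<in> E"
      then have "e \<subseteq> V" "card e = 2" using simple by (auto simp: simple_graph_def)
      then show "card {v \<in> V. v \<in> e} = 2" by (simp add: Collect_conj_eq Int_absorb1)
    qed
  qed
  finally have "real (card V) * real d = 2 * real (card E)"
    by (metis of_nat_mult of_nat_numeral)
  then have total: "(\<Sum>e\<in>E. 1 / real d) = real (card V) / 2"
    using d0 by (simp add: field_simps)
  have "cut_feasible V E 1 (\<lambda>e. 1 / real d)"
    using cut_card d0 by (simp add: cut_feasible_def pos_le_divide_eq)
  then show ?thesis by (rule cut_lp_value_eqI[OF n _ eq_refl[OF total]])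
qed

text \<open>A Hamiltonian cycle meets every cut at least twice: it leaves the vertex set and comes back. So
  the weight \<open>1 / 2\<close> on its edges is feasible.\<close>

lemma hamiltonian_cut_lp_value:
  assumes ham: "hamiltonian V E"
  shows "cut_lp_value V E = real (card V) / 2"
proof -
  obtain c where c: "is_cycle E c" "set c = V" using ham by (auto simp: hamiltonian_def)
  define n where "n = length c"
  have n3: "3 \<le> n" and dc: "distinct c" using c(1) by (simp_all add: is_cycle_def n_def)
  have n: "card V = n" using distinct_card[OF dc] c(2) by (simp add: n_def)
  define f where "f i = {c ! i, c ! (Suc i mod n)}" for i
  define H where "H = f ` {..<n}"
  have HE: "H \<subseteq> E" using c(1) by (auto simp: H_def f_def is_cycle_def n_def)
  have fH: "finite H" by (simp add: H_def)
  have cardH: "card H \<le> n" using card_image_le[of "{..<n}" f] by (simp add: H_def)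
  \<comment> \<open>walking once around the cycle, one leaves every proper nonempty vertex set\<close>
  have leave: "\<exists>i<n. c ! i \<in> Y \<and> c ! (Suc i mod n) \<notin> Y" if Y: "Y \<inter> V \<noteq> {}" "\<not> V \<subseteq> Y" for Y
  proof (rule ccontr)
    assume no: "\<not> ?thesis"
    obtain k where k: "k < n" "c ! k \<in> Y"
      using Y(1) unfolding c(2)[symmetric] by (auto simp: in_set_conv_nth n_def)
    have walk: "c ! ((k + m) mod n) \<in> Y" for m
    proof (induction m)
      case 0
      then show ?case using k by simp
    next
      case (Suc m)
      have "(k + m) mod n < n" using n3 by simp
      then have "c ! (Suc ((k + m) mod n) mod n) \<in> Y" using no Suc by blast
      then show ?case by (simp add: mod_Suc_eq)
    qed
    have "c ! j \<in> Y" if j: "j < n" for j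
      using walk[of "n - k + j"] k(1) j by simp
    then have "V \<subseteq> Y" unfolding c(2)[symmetric] by (auto simp: in_set_conv_nth n_def)
    with Y(2) show False by simp
  qed
  have two: "2 \<le> card (cut_edges E X \<inter> H)" if X: "X \<noteq> {}" "X \<subset> V" for X
  proof -
    obtain i where i: "i < n" "c ! i \<in> X" "c ! (Suc i mod n) \<notin> X"
      using leave[of X] X by blast
    obtain j where j: "j < n" "c ! j \<notin> X" "c ! (Suc j mod n) \<in> X"
      using leave[of "- X"] X by blast
    have ne: "f i \<noteq> f j"
    proof
      assume "f i = f j"
      then have "c ! i = c ! (Suc j mod n)" "c ! j = c ! (Suc i mod n)"
        using i j by (auto simp: f_def doubleton_eq_iff)
      moreover have "Suc i mod n < length c" "Suc j mod n < length c" "i < length c" "j < length c"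
        using i(1) j(1) n3 by (simp_all add: n_def[symmetric])
      ultimately have ij: "i = Suc j mod n" "j = Suc i mod n"
        using nth_eq_iff_index_eq[OF dc] by blast+
      have wrap: "Suc k mod n = (if Suc k = n then 0 else Suc k)" if "k < n" for k
        using that by (simp add: mod_Suc)
      note i_eq = trans[OF ij(1) wrap[OF j(1)]] and j_eq = trans[OF ij(2) wrap[OF i(1)]]
      show False
      proof (cases "Suc i = n")
        case True
        then have "j = 0" by (simp add: j_eq)
        then have "i \<le> 1" using i_eq by (simp split: if_splits)
        then show False using True n3 by linarith
      next
        case False
        then have "j = Suc i" by (simp add: j_eq)
        then have "i = 0 \<and> n = Suc (Suc i) \<or> i = Suc (Suc i)" using i_eq by presburger
        then show False using n3 by linarith
      qed
    qed
    have "{f i, f j} \<subseteq> cut_edges E X \<inter> H"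
      using i j HE by (auto simp: cut_edges_def f_def H_def)
    then have "card {f i, f j} \<le> card (cut_edges E X \<inter> H)"
      using fH by (intro card_mono) auto
    then show ?thesis using ne by simp
  qed
  define a where "a e = (if e \<in> H then 1 / 2 else 0 :: real)" for e
  have "cut_feasible V E 1 a"
    unfolding cut_feasible_def
  proof (intro conjI allI impI ballI)
    fix X assume X: "X \<noteq> {}" "X \<subset> V"
    have "finite (cut_edges E X)" using finE by (simp add: cut_edges_def)
    then have "(\<Sum>e\<in>cut_edges E X. a e) = real (card (cut_edges E X \<inter> H)) / 2"
      by (simp add: a_def sum.If_cases)
    then show "1 \<le> (\<Sum>e\<in>cut_edges E X. a e)" using two[OF X] by simp
  qed (simp add: a_def)
  moreover have "(\<Sum>e\<in>E. a e) \<le> real (card V) / 2"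
    using finE HE cardH n by (simp add: a_def sum.If_cases Int_absorb1)
  ultimately show ?thesis using n n3 by (intro cut_lp_value_eqI) simp_all
qed

end

text \<open>A dependent graphic matroid has a cycle, which has at least three vertices.\<close>

lemma three_le_card_of_dependent:
  assumes G: "simple_graph V E" and rk: "matroid_rank (graphic_matroid E) < card E"
  shows "3 \<le> card V"
proof -
  have finE: "finite E" by (rule simple_graph_finite[OF G])
  have "\<not> acyclic_edges E"
  proof
    assume "acyclic_edges E"
    then have "E \<in> {X. indep (graphic_matroid E) X}"
      by (simp add: indep_def ground_def graphic_matroid_def)
    moreover have "finite {X. indep (graphic_matroid E) X}"
      by (rule finite_subset[of _ "Pow E"]) (auto simp: finE indep_def ground_def graphic_matroid_def)
    ultimately have "card E \<le> matroid_rank (graphic_matroid E)"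
      unfolding matroid_rank_def by (intro Max_ge) auto
    with rk show False by simp
  qed
  then obtain c where c: "is_cycle E c" by (auto simp: acyclic_edges_def)
  have "set c \<subseteq> V"
  proof
    fix x assume "x \<in> set c"
    then obtain i where "i < length c" "x = c ! i" by (auto simp: in_set_conv_nth)
    then have "{x, c ! (Suc i mod length c)} \<in> E" using c by (simp add: is_cycle_def)
    then show "x \<in> V" using G by (auto simp: simple_graph_def)
  qed
  then have "card (set c) \<le> card V" using G by (intro card_mono) (auto simp: simple_graph_def)
  moreover have "card (set c) = length c" "3 \<le> length c"
    using c by (simp_all add: is_cycle_def distinct_card)
  ultimately show ?thesis by simp
qed

theorem theorem5p5:
  fixes V :: "'v set" and E :: "'v set set"
    and S :: "('v set, 'k::field) mpoly ring" and I :: "('v set, 'k) mpoly set"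
  assumes "simple_graph V E"
    and "two_connected V E"
    and "matroid_rank (graphic_matroid E) < card E"
  defines "S \<equiv> poly_ring E"
    and "I \<equiv> facet_ideal (graphic_matroid E)"
  shows "asymptotic_resurgence S I \<le> ereal (2 - 2 / real (card V)) \<and>
    (asymptotic_resurgence S I = ereal (2 - 2 / real (card V)) \<longleftrightarrow>
       waldschmidt S I = real (card V) / 2) \<and>
    (hamiltonian V E \<longrightarrow> asymptotic_resurgence S I = ereal (2 - 2 / real (card V))) \<and>
    (regular_graph V E \<and> edge_connectivity V E = min_degree V E \<longrightarrow>
       asymptotic_resurgence S I = ereal (2 - 2 / real (card V)))"
proof -
  have conn: "connected_graph V E" using assms(2) by (simp add: two_connected_def)
  interpret connected_simple_graph V E
  proof
    show "simple_graph V E" by (rule assms(1))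
    show "V \<noteq> {}" using conn by (simp add: connected_graph_def)
    then show "num_components V E = 1"
      using conn num_components_eq_1_iff[of V E] by (simp add: connected_graph_def)
  qed
  have n3: "3 \<le> card V" by (rule three_le_card_of_dependent[OF assms(1,3)])
  have n2: "2 \<le> card V" using n3 by simp
  have le: "asymptotic_resurgence S I \<le> ereal (2 - 2 / real (card V))"
    unfolding S_def I_def by (rule asymptotic_resurgence_upper[OF n2])
  have iff: "asymptotic_resurgence S I = ereal (2 - 2 / real (card V)) \<longleftrightarrow>
      cut_lp_value V E = real (card V) / 2"
  proof
    assume eq: "asymptotic_resurgence S I = ereal (2 - 2 / real (card V))"
    show "cut_lp_value V E = real (card V) / 2"
    proof (rule ccontr)
      assume "cut_lp_value V E \<noteq> real (card V) / 2"
      then have "real (card V) / 2 < cut_lp_value V E" using cut_lp_value_ge[OF n2] by simp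
      from asymptotic_resurgence_strict[OF n3 this, where ?'k = 'k] eq show False
        by (simp add: S_def I_def)
    qed
  next
    assume "cut_lp_value V E = real (card V) / 2"
    from asymptotic_resurgence_lower[OF n2 this, where ?'k = 'k] le
    show "asymptotic_resurgence S I = ereal (2 - 2 / real (card V))"
      unfolding S_def I_def by (intro antisym)
  qed
  have "waldschmidt S I = cut_lp_value V E"
    unfolding S_def I_def by (rule waldschmidt_eq_cut_lp_value)
  then show ?thesis
    using le iff hamiltonian_cut_lp_value regular_cut_lp_value[OF n2] by simp
qed

end
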